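(* Let $K$ be a regular compact set with $K\subset[-1,1]$ and $\pm1\in K$. Let $\alpha,\beta\in\mathbb N\cup\{0\}$ with $\alpha+\beta\geq1$, and let $$d\mu(x)=(1-x)^\alpha(1+x)^\beta\,d\mu_K(x).$$ Then for every $n\in\mathbb N$, $$[W_{2,n}(\mu)]^2\geq 2S(\mu).$$
   Context: $\mu_K$ is the equilibrium measure and $\mathrm{Cap}(K)$ the logarithmic capacity of $K$; regular means regular for the Dirichlet problem. For a finite positive Borel measure $\mu$ with support $K$, write the Lebesgue decomposition $d\mu=f\,d\mu_K+d\mu_s$ and set $S(\mu)=\exp\big[\int\log f(x)\,d\mu_K(x)\big]$. $P_n(\cdot;\mu)$ is the monic polynomial of degree $n$ minimizing $\|P_n\|_{L_2(\mu)}$, and $W_{2,n}(\mu)=\|P_n(\cdot;\mu)\|_{L_2(\mu)}/\mathrm{Cap}(\mathrm{supp}\,\mu)^n$. *)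

theory Defs
  imports "HOL-Analysis.Analysis" "HOL-Computational_Algebra.Polynomial"
begin

text \<open>Logarithmic energy of a Borel measure on the real line:
  I(nu) = double integral of log(1/|x-y|), split into positive and negative parts.\<close>
definition log_energy :: "real measure \<Rightarrow> ereal" where
  "log_energy \<nu> =
     enn2ereal (\<integral>\<^sup>+ x. \<integral>\<^sup>+ y. (if x = y then \<infinity> else ennreal (- ln \<bar>x - y\<bar>)) \<partial>\<nu> \<partial>\<nu>)
   - enn2ereal (\<integral>\<^sup>+ x. \<integral>\<^sup>+ y. (if x = y then 0 else ennreal (ln \<bar>x - y\<bar>)) \<partial>\<nu> \<partial>\<nu>)"

definition prob_measures_on :: "real set \<Rightarrow> real measure set" where
  "prob_measures_on K = {\<nu>. emeasure \<nu> UNIV = 1 \<and> sets \<nu> = sets borel \<and> emeasure \<nu> (UNIV - K) = 0}"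

definition robin_const :: "real set \<Rightarrow> ereal" where
  "robin_const K = (INF \<nu> \<in> prob_measures_on K. log_energy \<nu>)"

definition log_cap :: "real set \<Rightarrow> real" where
  "log_cap K = (if robin_const K = \<infinity> then 0 else exp (- real_of_ereal (robin_const K)))"

definition equilibrium_measure :: "real set \<Rightarrow> real measure" where
  "equilibrium_measure K =
     (THE \<nu>. \<nu> \<in> prob_measures_on K \<and> log_energy \<nu> = robin_const K)"

definition green_fun :: "real set \<Rightarrow> complex \<Rightarrow> real" where
  "green_fun K z = (\<integral> t. ln (cmod (z - complex_of_real t)) \<partial>equilibrium_measure K) - ln (log_cap K)"

text \<open>Regularity for the Dirichlet problem: positive capacity and the Green function
  tends to 0 at every point of K (= boundary of the complement, since K is real).\<close>
definition dirichlet_regular :: "real set \<Rightarrow> bool" where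
  "dirichlet_regular K \<longleftrightarrow> compact K \<and> log_cap K > 0 \<and>
     (\<forall>x\<in>K. (green_fun K \<longlongrightarrow> 0) (at (complex_of_real x) within - (complex_of_real ` K)))"

definition measure_support :: "real measure \<Rightarrow> real set" where
  "measure_support M = {x. \<forall>e>0. emeasure M (ball x e) \<noteq> 0}"

definition lebesgue_ac_density :: "real measure \<Rightarrow> real measure \<Rightarrow> (real \<Rightarrow> real) \<Rightarrow> bool" where
  "lebesgue_ac_density N M f \<longleftrightarrow> f \<in> borel_measurable borel \<and> (\<forall>x. f x \<ge> 0) \<and>
     (\<exists>ms. sets ms = sets borel \<and>
        (\<exists>A\<in>sets borel. emeasure N A = 0 \<and> emeasure ms (UNIV - A) = 0) \<and>
        (\<forall>A\<in>sets borel. emeasure M A = emeasure (density N (\<lambda>x. ennreal (f x))) A + emeasure ms A))"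

definition szego_S :: "real measure \<Rightarrow> real" where
  "szego_S M =
    (let N = equilibrium_measure (measure_support M);
         f = (SOME f. lebesgue_ac_density N M f);
         I = enn2ereal (\<integral>\<^sup>+ x. ennreal (ln (f x)) \<partial>N)
           - enn2ereal (\<integral>\<^sup>+ x. (if f x = 0 then \<infinity> else ennreal (- ln (f x))) \<partial>N)
     in if I = - \<infinity> then 0 else exp (real_of_ereal I))"

text \<open>Squared L2(mu) norm of the monic orthogonal polynomial of degree n
  (the minimum over monic real polynomials of degree n), and the Widom factor.\<close>
definition min_monic_norm2 :: "real measure \<Rightarrow> nat \<Rightarrow> real" where
  "min_monic_norm2 M n =
     Inf {(\<integral> x. (poly p x)\<^sup>2 \<partial>M) | p :: real poly. degree p = n \<and> lead_coeff p = 1}"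

definition widom2 :: "real measure \<Rightarrow> nat \<Rightarrow> real" where
  "widom2 M n = sqrt (min_monic_norm2 M n) / log_cap (measure_support M) ^ n"

end

theory Submission
  imports Defs "HOL-Probability.Probability" "HOL-Real_Asymp.Real_Asymp"
begin

text \<open>
  Put \<open>Q = P\<^sup>2 (1 - x)^\<alpha> (1 + x)^\<beta>\<close>, a polynomial of degree \<open>N = 2 n + \<alpha> + \<beta>\<close> with leading coefficient
  \<open>\<plusminus>1\<close> that is nonnegative on \<open>K\<close>. Regularity makes the potential of \<open>\<mu>\<^sub>K\<close> constant on \<open>K\<close>, so
  \<open>S(\<mu>) = Cap(K)^(\<alpha> + \<beta>)\<close>, and the claim is \<open>\<integral>Q d\<mu>\<^sub>K \<ge> 2 Cap(K)^N\<close>.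

  Let \<open>X \<subseteq> K\<close> have \<open>L\<close> points with almost maximal Vandermonde product. In the orthonormal polynomials of
  the counting measure on \<open>X\<close>, multiplication by \<open>Q\<close> is a positive banded matrix with trace
  \<open>\<Sum>x\<in>X. Q x\<close>. Its Cholesky factor is expressed by the orthogonal polynomials for the weight \<open>Q\<close>;
  if \<open>h\<^sub>k\<close> and \<open>h'\<^sub>k\<close> are the squared norms for the weights \<open>1\<close> and \<open>Q\<close>, keeping only the two extreme
  entries of each column gives
  \<open>\<Sum>x\<in>X. Q x \<ge> \<Sum>k. h'\<^sub>k / h\<^sub>k + h\<^sub>k\<^sub>+\<^sub>N / h'\<^sub>k \<ge> 2 (\<Sum>k. sqrt (h\<^sub>k\<^sub>+\<^sub>N / h\<^sub>k))\<close>. By the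
  arithmetic-geometric mean inequality and the telescoping of the \<open>h\<^sub>k\<close> the right-hand side is at least
  \<open>2 L Cap(K)^N (1 - o(1))\<close>. As \<open>L \<rightarrow> \<infinity>\<close> the normalised counting measures of the sets \<open>X\<close>
  converge to \<open>\<mu>\<^sub>K\<close> along a subsequence.

  The potential theory rests on the Chebyshev expansion of the logarithmic kernel on \<open>[-1, 1]\<close>, which
  turns the energy of a probability measure into a weighted sum of squares of its Chebyshev coefficients;
  strict convexity and lower semicontinuity of the energy are then immediate.
\<close>

section \<open>Monic orthogonal polynomials on finite sets\<close>

text \<open>Subtracting \<open>lead_coeff q\<close> times \<open>P (degree q)\<close> lowers the
  degree, so one monic polynomial per degree spans everything below degree \<open>n\<close>. In the
  applications \<open>Z\<close> is an identity linear in the polynomial.\<close>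

lemma poly_monic_basis_induct:
  fixes P :: "nat \<Rightarrow> real poly"
  assumes P: "\<And>j. j < n \<Longrightarrow> degree (P j) = j \<and> lead_coeff (P j) = 1"
    and Z: "\<And>j. j < n \<Longrightarrow> Z (P j)" "Z 0" "\<And>p q c. Z p \<Longrightarrow> Z q \<Longrightarrow> Z (p + smult c q)"
    and "degree q < n"
  shows "Z q"
  using \<open>degree q < n\<close>
proof (induction "degree q" arbitrary: q rule: less_induct)
  case less
  let ?d = "degree q"
  define r where "r = q - smult (lead_coeff q) (P ?d)"
  have dP: "degree (P ?d) = ?d" "lead_coeff (P ?d) = 1"
    using P less.prems by blast+
  have q: "q = r + smult (lead_coeff q) (P ?d)"
    by (simp add: r_def)
  have "degree r \<le> ?d"
    unfolding r_def by (rule degree_diff_le) (use dP in auto)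
  moreover have "coeff r ?d = 0"
    using dP by (simp add: r_def)
  ultimately have "r = 0 \<or> degree r < ?d"
    by (metis leading_coeff_0_iff le_neq_implies_less)
  then have "Z r"
    using less Z(2) by (metis order.strict_trans)
  then have "Z (r + smult (lead_coeff q) (P ?d))"
    by (intro Z less.prems)
  then show ?case
    by (simp add: r_def)
qed

section \<open>Lagrange interpolation on a finite set of nodes\<close>

definition lagrange_numerator :: "real set \<Rightarrow> real \<Rightarrow> real poly" where
  "lagrange_numerator X x = (\<Prod>y\<in>X - {x}. [:- y, 1:])"

lemma poly_lagrange_numerator: "poly (lagrange_numerator X x) z = (\<Prod>y\<in>X - {x}. z - y)"
  by (simp add: lagrange_numerator_def poly_prod)

lemma degree_lagrange_numerator:
  "finite X \<Longrightarrow> x \<in> X \<Longrightarrow> degree (lagrange_numerator X x) = card X - 1"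
  "lead_coeff (lagrange_numerator X x) = 1"
proof -
  have "degree (\<Prod>y\<in>A. [:- y, 1:]) = card A \<and> lead_coeff (\<Prod>y\<in>A. [:- y, 1:]) = 1"
    if "finite A" for A :: "real set"
    using that
  proof (induction A rule: finite_induct)
    case (insert a A)
    moreover have "degree ([:- a, 1:] * (\<Prod>y\<in>A. [:- y, 1:])) = Suc (card A)"
      by (subst degree_mult_eq) (use insert in auto)
    moreover have "lead_coeff ([:- a, 1:] * (\<Prod>y\<in>A. [:- y, 1:])) = 1"
      by (subst lead_coeff_mult) (use insert in auto)
    ultimately show ?case
      using insert.hyps by (simp only: prod.insert card_insert_disjoint if_True simp_thms)
  qed auto
  note * = this
  then show "finite X \<Longrightarrow> x \<in> X \<Longrightarrow> degree (lagrange_numerator X x) = card X - 1"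
    by (simp add: lagrange_numerator_def)
  show "lead_coeff (lagrange_numerator X x) = 1"
  proof (cases "finite (X - {x})")
    case True
    then show ?thesis
      unfolding lagrange_numerator_def using * by blast
  next
    case False
    then show ?thesis
      by (simp only: lagrange_numerator_def prod.infinite) simp
  qed
qed

lemma poly_lagrange_numerator_other:
  "finite X \<Longrightarrow> z \<in> X \<Longrightarrow> z \<noteq> x \<Longrightarrow> poly (lagrange_numerator X x) z = 0"
  by (auto simp: poly_lagrange_numerator intro!: bexI[of _ z])

lemma poly_lagrange_numerator_self:
  "finite X \<Longrightarrow> poly (lagrange_numerator X x) x \<noteq> 0"
  by (auto simp: poly_lagrange_numerator)

lemma poly_eq_0_if_many_zeros:
  fixes p :: "real poly"
  assumes "finite X" "degree p < card X" "\<And>x. x \<in> X \<Longrightarrow> poly p x = 0"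
  shows "p = 0"
proof (rule ccontr)
  assume "p \<noteq> 0"
  then have "card X \<le> card {x. poly p x = 0}"
    using assms by (intro card_mono poly_roots_finite) auto
  also have "\<dots> \<le> degree p"
    by (rule card_poly_roots_bound[OF \<open>p \<noteq> 0\<close>])
  finally show False
    using assms by simp
qed

text \<open>Both sides are the coefficient of degree \<open>card X - 1\<close> in the interpolation
  formula, each Lagrange numerator being monic. Later this bounds the last orthogonal norm from
  below.\<close>

lemma lagrange_lead_coeff:
  fixes p :: "real poly"
  assumes "finite X" "degree p = card X - 1" "X \<noteq> {}"
  shows "lead_coeff p = (\<Sum>x\<in>X. poly p x / (\<Prod>y\<in>X - {x}. x - y))"
proof -
  define c where "c x = poly p x / poly (lagrange_numerator X x) x" for x
  define r where "r = p - (\<Sum>x\<in>X. smult (c x) (lagrange_numerator X x))"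
  have cX: "card X > 0"
    using assms by (simp add: card_gt_0_iff)
  have "degree (\<Sum>x\<in>X. smult (c x) (lagrange_numerator X x)) \<le> card X - 1"
    by (rule degree_sum_le) (use assms degree_lagrange_numerator in auto)
  then have "degree r \<le> card X - 1"
    unfolding r_def by (intro degree_diff_le) (use assms in auto)
  then have "degree r < card X"
    using cX by linarith
  moreover have "poly r z = 0" if "z \<in> X" for z
  proof -
    have "(\<Sum>x\<in>X. c x * poly (lagrange_numerator X x) z) = (\<Sum>x\<in>X. if x = z then poly p z else 0)"
      using assms that
      by (intro sum.cong refl) (auto simp: c_def poly_lagrange_numerator_other poly_lagrange_numerator_self)
    then show ?thesis
      using assms that by (simp add: r_def poly_sum)
  qed
  ultimately have "r = 0"
    using poly_eq_0_if_many_zeros assms by blast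
  then have "coeff p (card X - 1) = (\<Sum>x\<in>X. c x * coeff (lagrange_numerator X x) (card X - 1))"
    by (simp add: r_def coeff_sum)
  also have "\<dots> = (\<Sum>x\<in>X. c x)"
    using degree_lagrange_numerator[of X] assms by (intro sum.cong) (metis mult.right_neutral)+
  finally show ?thesis
    using assms by (simp add: c_def poly_lagrange_numerator)
qed

section \<open>Monic orthogonal polynomials for a positive weight on a finite set\<close>

locale finite_weight =
  fixes X :: "real set" and w :: "real \<Rightarrow> real"
  assumes finite_nodes: "finite X" and weight_pos: "\<And>x. x \<in> X \<Longrightarrow> w x > 0"
begin

definition ip :: "real poly \<Rightarrow> real poly \<Rightarrow> real" where
  "ip p q = (\<Sum>x\<in>X. w x * (poly p x * poly q x))"

definition monic_orth :: "nat \<Rightarrow> real poly \<Rightarrow> bool" where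
  "monic_orth k p \<longleftrightarrow> degree p = k \<and> lead_coeff p = 1 \<and> (\<forall>q. degree q < k \<longrightarrow> ip p q = 0)"

definition P :: "nat \<Rightarrow> real poly" where
  "P k = (SOME p. monic_orth k p)"

definition h :: "nat \<Rightarrow> real" where
  "h k = ip (P k) (P k)"

lemma ip_add: "ip p (q + r) = ip p q + ip p r" "ip (q + r) p = ip q p + ip r p"
  by (simp_all add: ip_def algebra_simps sum.distrib)

lemma ip_diff: "ip p (q - r) = ip p q - ip p r" "ip (q - r) p = ip q p - ip r p"
  by (simp_all add: ip_def algebra_simps sum_subtractf)

lemma ip_smult: "ip p (smult c q) = c * ip p q" "ip (smult c q) p = c * ip q p"
  by (simp_all add: ip_def algebra_simps sum_distrib_left)

lemma ip_0: "ip p 0 = 0" "ip 0 p = 0"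
  by (simp_all add: ip_def)

lemma ip_sum: "ip (\<Sum>i\<in>A. f i) p = (\<Sum>i\<in>A. ip (f i) p)"
  by (induction A rule: infinite_finite_induct) (simp_all add: ip_0 ip_add)

lemma ip_commute: "ip p q = ip q p"
  by (simp add: ip_def mult.commute)

lemma ip_self_nonneg: "ip p p \<ge> 0"
  unfolding ip_def using weight_pos by (intro sum_nonneg) (simp add: less_imp_le)

lemma ip_self_pos:
  assumes "p \<noteq> 0" "degree p < card X"
  shows "ip p p > 0"
proof -
  obtain x where x: "x \<in> X" "poly p x \<noteq> 0"
    using poly_eq_0_if_many_zeros[OF finite_nodes] assms by blast
  then have "0 < w x * (poly p x * poly p x)"
    using weight_pos by (metis mult_pos_pos not_square_less_zero linorder_less_linear mult_eq_0_iff)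
  also have "\<dots> \<le> ip p p"
    unfolding ip_def using x finite_nodes weight_pos
    by (intro member_le_sum[of x X "\<lambda>x. w x * (poly p x * poly p x)"]) (auto simp: less_imp_le)
  finally show ?thesis .
qed

text \<open>Gram-Schmidt applied to \<open>monom 1 k\<close>. Only norms in degrees below
  \<open>k\<close> are divided by, and a nonzero polynomial of degree less than
  \<open>card X\<close> cannot vanish on \<open>X\<close>; hence \<open>k = card X\<close> is still
  allowed.\<close>

lemma monic_orth_exists:
  assumes "k \<le> card X"
  shows "\<exists>p. monic_orth k p"
  using assms
proof (induction k rule: less_induct)
  case (less k)
  then have "\<forall>j. \<exists>p. j < k \<longrightarrow> monic_orth j p"
    by (meson less_imp_le_nat order.trans)
  then obtain R where R: "\<And>j. j < k \<Longrightarrow> monic_orth j (R j)"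
    by metis
  have pos: "ip (R j) (R j) > 0" if "j < k" for j
    using R[OF that] that less.prems by (intro ip_self_pos) (auto simp: monic_orth_def)
  have orth: "ip (R i) (R j) = 0" if "i < k" "j < k" "i \<noteq> j" for i j
    using R that unfolding monic_orth_def by (metis ip_commute linorder_neqE_nat)
  define s where "s = (\<Sum>j<k. smult (ip (monom 1 k) (R j) / ip (R j) (R j)) (R j))"
  define p where "p = monom 1 k - s"
  have s0: "coeff s i = 0" if "i \<ge> k" for i
  proof -
    have "coeff (R j) i = 0" if "j < k" for j
      using R[OF that] \<open>i \<ge> k\<close> that by (intro coeff_eq_0) (auto simp: monic_orth_def)
    then show ?thesis
      by (simp add: s_def coeff_sum)
  qed
  have "coeff p k = 1" "\<And>i. i > k \<Longrightarrow> coeff p i = 0"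
    using s0 by (simp_all add: p_def)
  then have deg: "degree p = k" "lead_coeff p = 1"
    by (metis le_degree zero_neq_one degree_le le_antisym)+
  have pR: "ip p (R i) = 0" if "i < k" for i
  proof -
    have "ip s (R i) = (\<Sum>j<k. if j = i then ip (monom 1 k) (R i) else 0)"
      unfolding s_def ip_sum using pos orth that
      by (intro sum.cong refl) (auto simp: ip_smult, metis less_irrefl)
    then show ?thesis
      using that by (simp add: p_def ip_diff)
  qed
  have "ip p q = 0" if "degree q < k" for q
  proof (rule poly_monic_basis_induct[of k R "\<lambda>q. ip p q = 0", OF _ pR _ _ that])
    show "degree (R j) = j \<and> lead_coeff (R j) = 1" if "j < k" for j
      using R[OF that] unfolding monic_orth_def by blast
  qed (auto simp: ip_0 ip_add ip_smult)
  with deg show ?case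
    by (auto simp: monic_orth_def)
qed

lemma monic_orth_P: "k \<le> card X \<Longrightarrow> monic_orth k (P k)"
  unfolding P_def using someI_ex[OF monic_orth_exists] by blast

lemma degree_P: "k \<le> card X \<Longrightarrow> degree (P k) = k"
  and monic_P: "k \<le> card X \<Longrightarrow> coeff (P k) k = 1"
  and ip_P_lower: "k \<le> card X \<Longrightarrow> degree q < k \<Longrightarrow> ip (P k) q = 0"
  using monic_orth_P[of k] by (auto simp: monic_orth_def)

lemma h_pos: "k < card X \<Longrightarrow> h k > 0"
  unfolding h_def using degree_P[of k] monic_P[of k] by (intro ip_self_pos) auto

lemma ip_P_eq_coeff:
  assumes "k \<le> card X" "degree q \<le> k"
  shows "ip (P k) q = coeff q k * h k"
proof -
  define r where "r = q - smult (coeff q k) (P k)"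
  have "degree r \<le> k"
    unfolding r_def by (rule degree_diff_le) (use assms degree_P in auto)
  moreover have "coeff r k = 0"
    using assms monic_P by (simp add: r_def)
  ultimately have "r = 0 \<or> degree r < k"
    by (metis leading_coeff_0_iff le_neq_implies_less)
  then have "ip (P k) r = 0"
    using ip_P_lower assms by (auto simp: ip_0)
  then show ?thesis
    by (simp add: r_def ip_diff ip_smult h_def)
qed

text \<open>Expand the squared norm of \<open>q - P k\<close>: the cross term is \<open>h k\<close>
  because \<open>q\<close> is monic.\<close>

lemma h_minimal:
  assumes "k \<le> card X" "degree q = k" "lead_coeff q = 1"
  shows "h k \<le> ip q q"
proof -
  have "0 \<le> ip (q - P k) (q - P k)"
    by (rule ip_self_nonneg)
  also have "\<dots> = ip q q - 2 * ip (P k) q + h k"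
    by (simp add: ip_diff h_def ip_commute)
  also have "ip (P k) q = h k"
    using ip_P_eq_coeff assms by auto
  finally show ?thesis
    by simp
qed

text \<open>The product of \<open>x\<close> and \<open>P k\<close> is a monic competitor of degree
  \<open>k + 1\<close>, and \<open>x^2 <= 1\<close> on the nodes keeps its norm from
  growing.\<close>

lemma h_Suc_le:
  assumes "X \<subseteq> {-1..1}" "Suc k \<le> card X"
  shows "h (Suc k) \<le> h k"
proof -
  have deg: "degree (P k) = k" "lead_coeff (P k) = 1"
    using degree_P[of k] monic_P[of k] assms by auto
  then have "degree (pCons 0 (P k)) = Suc k"
    by (subst degree_pCons_eq) auto
  then have "h (Suc k) \<le> ip (pCons 0 (P k)) (pCons 0 (P k))"
    using deg assms by (intro h_minimal) auto
  also have "\<dots> = (\<Sum>x\<in>X. w x * (x\<^sup>2 * (poly (P k) x)\<^sup>2))"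
    by (simp add: ip_def power2_eq_square algebra_simps)
  also have "\<dots> \<le> (\<Sum>x\<in>X. w x * (1 * (poly (P k) x)\<^sup>2))"
    using assms by (intro sum_mono mult_left_mono mult_right_mono less_imp_le[OF weight_pos])
      (auto simp: abs_square_le_1 abs_le_iff)
  also have "\<dots> = h k"
    by (simp add: h_def ip_def power2_eq_square)
  finally show ?thesis .
qed

lemma h_antimono:
  assumes "X \<subseteq> {-1..1}" "i \<le> j" "j \<le> card X"
  shows "h j \<le> h i"
  using assms(2,3)
proof (induction j rule: dec_induct)
  case (step j)
  then show ?case
    using h_Suc_le[OF assms(1), of j] by simp
qed simp

text \<open>The orthonormal polynomials form a square orthogonal matrix, so its columns are normalised too.\<close>
lemma sum_P_square_eq:
  assumes x: "x \<in> X"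
  shows "(\<Sum>k<card X. (poly (P k) x)\<^sup>2 / h k) = 1 / w x"
proof -
  \<comment> \<open>\<open>q\<close> is the reproducing kernel at \<open>x\<close>: pairing with it
    evaluates polynomials of degree below \<open>card X\<close> at \<open>x\<close>. Pairing it with
    the Lagrange numerator, which vanishes at all other nodes, isolates the value of
    \<open>q\<close> at \<open>x\<close>.\<close>
  define q where "q = (\<Sum>k<card X. smult (poly (P k) x / h k) (P k))"
  have qP: "ip q (P j) = poly (P j) x" if "j < card X" for j
  proof -
    have "ip (P k) (P j) = 0" if "k < card X" "k \<noteq> j" for k
    proof (cases "j < k")
      case True
      then show ?thesis
        using that by (intro ip_P_lower) (auto simp: degree_P)
    next
      case False
      then show ?thesis
        using that \<open>j < card X\<close>
        by (subst ip_commute, intro ip_P_lower) (auto simp: degree_P)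
    qed
    then have "ip q (P j) = (\<Sum>k<card X. if k = j then poly (P j) x else 0)"
      unfolding q_def ip_sum using h_pos[OF that]
      by (intro sum.cong refl) (auto simp: ip_smult h_def)
    then show ?thesis
      using that by simp
  qed
  have c: "card X > 0"
    using x finite_nodes card_gt_0_iff by blast
  let ?l = "lagrange_numerator X x"
  have "ip q ?l = poly ?l x"
  proof (rule poly_monic_basis_induct[of "card X" P "\<lambda>p. ip q p = poly p x", OF _ qP])
    show "degree (P j) = j \<and> lead_coeff (P j) = 1" if "j < card X" for j
      using degree_P[of j] monic_P[of j] that by simp
    show "degree ?l < card X"
      using degree_lagrange_numerator(1)[OF finite_nodes x] c by simp
  qed (auto simp: ip_0 ip_add ip_smult)
  moreover have "ip q ?l = (\<Sum>y\<in>X. if y = x then w x * (poly q x * poly ?l x) else 0)"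
    unfolding ip_def using finite_nodes
    by (intro sum.cong refl) (auto simp: poly_lagrange_numerator_other)
  ultimately have "w x * poly q x = 1"
    using finite_nodes x poly_lagrange_numerator_self[OF finite_nodes, of x] by simp
  then show ?thesis
    using weight_pos[OF x] by (simp add: q_def poly_sum power2_eq_square field_simps)
qed

text \<open>Bessel's inequality for two orthogonal directions. It will retain the two extreme terms
  when one orthogonal basis is expanded in another.\<close>

lemma bessel_two:
  assumes "ip a b = 0" "ip a a > 0" "ip b b > 0"
  shows "(ip p a)\<^sup>2 / ip a a + (ip p b)\<^sup>2 / ip b b \<le> ip p p"
proof -
  define s where "s = ip p a / ip a a"
  define t where "t = ip p b / ip b b"
  have "0 \<le> ip (p - smult s a - smult t b) (p - smult s a - smult t b)"
    by (rule ip_self_nonneg)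
  also have "\<dots> = ip p p - 2 * s * ip p a - 2 * t * ip p b + s\<^sup>2 * ip a a + t\<^sup>2 * ip b b"
    using assms(1) ip_commute[of b a] ip_commute[of a p] ip_commute[of b p]
    by (simp only: ip_diff ip_smult power2_eq_square) (simp add: algebra_simps)
  also have "s\<^sup>2 * ip a a = (ip p a)\<^sup>2 / ip a a"
    using assms by (simp add: s_def power2_eq_square)
  also have "t\<^sup>2 * ip b b = (ip p b)\<^sup>2 / ip b b"
    using assms by (simp add: t_def power2_eq_square)
  finally show ?thesis
    by (simp add: s_def t_def power2_eq_square)
qed

end

section \<open>Trace inequality for a polynomial weight on a finite set\<close>

lemma two_mult_le_sum_inverse_ratio:
  fixes a b c :: real
  assumes "a > 0" "b > 0" "c > 0"
  shows "b / a + c / b \<ge> 2 * sqrt (c / a)"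
proof -
  have "0 \<le> (sqrt (b / a) - sqrt (c / b))\<^sup>2"
    by simp
  also have "\<dots> = b / a + c / b - 2 * (sqrt (b / a) * sqrt (c / b))"
    using assms by (simp add: power2_diff)
  also have "sqrt (b / a) * sqrt (c / b) = sqrt (c / a)"
    using assms by (simp flip: real_sqrt_mult)
  finally show ?thesis
    by simp
qed

text \<open>This is \<open>ln z <= z - 1\<close> at \<open>z = sqrt t / c\<close>, sharp for
  \<open>sqrt t = c\<close>. Being linear in \<open>ln t\<close>, it lets a sum over degrees
  telescope: the arithmetic-geometric mean inequality with the mean \<open>c\<close> fixed in
  advance.\<close>

lemma sqrt_ge_tangent_ln:
  fixes c t :: real
  assumes "c > 0" "t > 0"
  shows "sqrt t \<ge> c * (1 + ln t / 2 - ln c)"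
proof -
  have "ln (sqrt t / c) \<le> sqrt t / c - 1"
    using assms by (intro ln_le_minus_one) auto
  then have "1 + ln t / 2 - ln c \<le> sqrt t / c"
    using assms by (simp add: ln_div ln_sqrt)
  then show ?thesis
    using assms by (simp add: field_simps)
qed

lemma sum_diff_shift:
  fixes f :: "nat \<Rightarrow> real"
  assumes "N \<le> L"
  shows "(\<Sum>k<L - N. f (k + N) - f k) = (\<Sum>k\<in>{L - N..<L}. f k) - (\<Sum>k<N. f k)"
proof -
  have "(\<Sum>k<L - N. f (k + N)) = (\<Sum>k\<in>{N..<L}. f k)"
    using sum.shift_bounds_nat_ivl[of f 0 N "L - N"] assms by (simp add: lessThan_atLeast0)
  moreover have "(\<Sum>k<L. f k) = (\<Sum>k<N. f k) + (\<Sum>k\<in>{N..<L}. f k)"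
    using sum.atLeastLessThan_concat[of 0 N L f] assms by (simp add: lessThan_atLeast0)
  moreover have "(\<Sum>k<L. f k) = (\<Sum>k<L - N. f k) + (\<Sum>k\<in>{L - N..<L}. f k)"
    using sum.atLeastLessThan_concat[of 0 "L - N" L f] assms by (simp add: lessThan_atLeast0)
  ultimately show ?thesis
    by (simp add: sum_subtractf)
qed

text \<open>\<open>u\<close> carries the counting measure and \<open>v\<close> the weight
  \<open>Q\<close>. The trace of multiplication by \<open>Q\<close> is computed in the basis
  \<open>u.P\<close> and estimated through the basis \<open>v.P\<close>. The tangency point
  \<open>c\<close> is free; \<open>d\<close> enters only through the smallest norm
  \<open>u.h (L - 1)\<close>.\<close>

lemma sum_poly_ge_pos:
  fixes Q :: "real poly" and X :: "real set"
  assumes X: "finite X" "X \<subseteq> {-1..1}" "card X > degree Q"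
    and Q: "\<bar>lead_coeff Q\<bar> = 1" "\<And>x. x \<in> X \<Longrightarrow> poly Q x > 0"
    and d: "d > 0" "\<And>x. x \<in> X \<Longrightarrow> d \<le> (\<Prod>y\<in>X - {x}. \<bar>x - y\<bar>)"
    and c: "c > 0" and N: "degree Q > 0"
  shows "(\<Sum>x\<in>X. poly Q x) \<ge>
    2 * c * ((real (card X) - degree Q) * (1 - ln c) + degree Q * ln (d / card X))"
proof -
  define L N where "L = card X" and "N = degree Q"
  have LN: "N < L" "N > 0" "X \<noteq> {}"
    using X N by (auto simp: L_def N_def)
  interpret u: finite_weight X "\<lambda>_. 1"
    by standard (use X in auto)
  interpret v: finite_weight X "poly Q"
    by standard (use X Q in auto)
  have trace: "(\<Sum>x\<in>X. poly Q x) = (\<Sum>k<L. v.ip (u.P k) (u.P k) / u.h k)"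
  proof -
    have "(\<Sum>x\<in>X. poly Q x) = (\<Sum>x\<in>X. poly Q x * (\<Sum>k<L. (poly (u.P k) x)\<^sup>2 / u.h k))"
      using u.sum_P_square_eq by (intro sum.cong) (auto simp: L_def)
    also have "\<dots> = (\<Sum>x\<in>X. \<Sum>k<L. poly Q x * (poly (u.P k) x)\<^sup>2 / u.h k)"
      by (simp add: sum_distrib_left)
    also have "\<dots> = (\<Sum>k<L. \<Sum>x\<in>X. poly Q x * (poly (u.P k) x)\<^sup>2 / u.h k)"
      by (rule sum.swap)
    also have "\<dots> = (\<Sum>k<L. v.ip (u.P k) (u.P k) / u.h k)"
      by (simp add: v.ip_def power2_eq_square sum_divide_distrib)
    finally show ?thesis .
  qed
  have diag: "v.ip (u.P k) (v.P k) = v.h k" if "k < L" for k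
    using that v.ip_P_eq_coeff[of k "u.P k"] u.degree_P[of k] u.monic_P[of k]
    by (simp add: v.ip_commute[of "u.P k"] L_def)
  have low: "v.ip (u.P k) (u.P k) \<ge> v.h k" if "k < L" for k
    using that u.degree_P[of k] u.monic_P[of k] by (intro v.h_minimal) (auto simp: L_def)
  \<comment> \<open>Moving \<open>Q\<close> from the weight into the second argument gives a
    polynomial of degree exactly \<open>k + N\<close>, of which only the leading coefficient counts.
    Squaring removes its sign.\<close>
  have outer: "(v.ip (u.P (k + N)) (v.P k))\<^sup>2 = (u.h (k + N))\<^sup>2" if "k + N < L" for k
  proof -
    have dv: "degree (v.P k) = k" "coeff (v.P k) k = 1"
      using v.degree_P[of k] v.monic_P[of k] that by (auto simp: L_def)
    have "Q \<noteq> 0" "v.P k \<noteq> 0"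
      using Q dv by auto
    then have deg: "degree (Q * v.P k) = k + N"
      using dv by (simp add: degree_mult_eq N_def)
    have "v.ip (u.P (k + N)) (v.P k) = u.ip (u.P (k + N)) (Q * v.P k)"
      by (simp add: u.ip_def v.ip_def algebra_simps)
    also have "\<dots> = lead_coeff (Q * v.P k) * u.h (k + N)"
      using that deg by (subst u.ip_P_eq_coeff) (auto simp: L_def)
    also have "lead_coeff (Q * v.P k) = lead_coeff Q"
      using dv by (simp add: lead_coeff_mult)
    finally show ?thesis
      using Q(1) by (metis abs_mult mult_1 power2_abs)
  qed
  have high: "v.ip (u.P (k + N)) (u.P (k + N)) \<ge> v.h (k + N) + (u.h (k + N))\<^sup>2 / v.h k"
    if "k + N < L" for k
  proof -
    have "(v.ip (u.P (k + N)) (v.P (k + N)))\<^sup>2 / v.h (k + N) + (v.ip (u.P (k + N)) (v.P k))\<^sup>2 / v.h k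
      \<le> v.ip (u.P (k + N)) (u.P (k + N))"
      unfolding v.h_def
      using that LN v.degree_P[of k] v.h_pos[of k] v.h_pos[of "k + N"]
      by (intro v.bessel_two v.ip_P_lower) (auto simp: L_def v.h_def)
    then show ?thesis
      using v.h_pos[of "k + N"] that unfolding diag[OF that] outer[OF that]
      by (simp add: power2_eq_square L_def)
  qed
  \<comment> \<open>The first \<open>N\<close> degrees have no partner \<open>N\<close> places below
    them, so they keep only the diagonal bound \<open>low\<close>.\<close>
  have "(\<Sum>k<L. v.ip (u.P k) (u.P k) / u.h k)
     = (\<Sum>k<N. v.ip (u.P k) (u.P k) / u.h k) + (\<Sum>k<L - N. v.ip (u.P (k + N)) (u.P (k + N)) / u.h (k + N))"
    using LN sum.atLeastLessThan_concat[of 0 N L "\<lambda>k. v.ip (u.P k) (u.P k) / u.h k"]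
      sum.shift_bounds_nat_ivl[of "\<lambda>k. v.ip (u.P k) (u.P k) / u.h k" 0 N "L - N"]
    by (simp add: lessThan_atLeast0)
  also have "\<dots> \<ge> (\<Sum>k<N. v.h k / u.h k) + (\<Sum>k<L - N. v.h (k + N) / u.h (k + N) + u.h (k + N) / v.h k)"
  proof (intro add_mono sum_mono)
    fix k assume "k \<in> {..<N}"
    then show "v.h k / u.h k \<le> v.ip (u.P k) (u.P k) / u.h k"
      using LN low[of k] u.h_pos[of k] by (intro divide_right_mono) (auto simp: L_def)
  next
    fix k assume "k \<in> {..<L - N}"
    then have "k + N < L" "u.h (k + N) > 0"
      using u.h_pos[of "k + N"] by (auto simp: L_def)
    then have "(v.h (k + N) + (u.h (k + N))\<^sup>2 / v.h k) / u.h (k + N) \<le> v.ip (u.P (k + N)) (u.P (k + N)) / u.h (k + N)"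
      by (intro divide_right_mono high) auto
    then show "v.h (k + N) / u.h (k + N) + u.h (k + N) / v.h k \<le> v.ip (u.P (k + N)) (u.P (k + N)) / u.h (k + N)"
      using \<open>u.h (k + N) > 0\<close> by (simp add: add_divide_distrib power2_eq_square)
  qed
  also have "(\<Sum>k<N. v.h k / u.h k) + (\<Sum>k<L - N. v.h (k + N) / u.h (k + N) + u.h (k + N) / v.h k)
      = (\<Sum>k<L. v.h k / u.h k) + (\<Sum>k<L - N. u.h (k + N) / v.h k)"
    using LN sum.atLeastLessThan_concat[of 0 N L "\<lambda>k. v.h k / u.h k"]
      sum.shift_bounds_nat_ivl[of "\<lambda>k. v.h k / u.h k" 0 N "L - N"]
    by (simp add: lessThan_atLeast0 sum.distrib)
  finally have "(\<Sum>k<L. v.ip (u.P k) (u.P k) / u.h k) \<ge> (\<Sum>k<L. v.h k / u.h k) + (\<Sum>k<L - N. u.h (k + N) / v.h k)" .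
  \<comment> \<open>Dropping the last \<open>N\<close> ratios pairs each
    \<open>v.h k / u.h k\<close> with \<open>u.h (k + N) / v.h k\<close>; in the product of the two,
    \<open>v.h k\<close> cancels.\<close>
  moreover have "(\<Sum>k<L. v.h k / u.h k) \<ge> (\<Sum>k<L - N. v.h k / u.h k)"
    using u.h_pos v.h_pos by (intro sum_mono2) (auto simp: L_def less_imp_le)
  ultimately have "(\<Sum>x\<in>X. poly Q x) \<ge> (\<Sum>k<L - N. v.h k / u.h k + u.h (k + N) / v.h k)"
    by (simp add: trace sum.distrib)
  moreover have "(\<Sum>k<L - N. v.h k / u.h k + u.h (k + N) / v.h k)
      \<ge> (\<Sum>k<L - N. 2 * c * (1 + (ln (u.h (k + N)) - ln (u.h k)) / 2 - ln c))"
  proof (intro sum_mono)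
    fix k assume "k \<in> {..<L - N}"
    then have p: "u.h k > 0" "v.h k > 0" "u.h (k + N) > 0"
      using u.h_pos v.h_pos by (auto simp: L_def)
    have "2 * (c * (1 + ln (u.h (k + N) / u.h k) / 2 - ln c)) \<le> 2 * sqrt (u.h (k + N) / u.h k)"
      using sqrt_ge_tangent_ln[OF c, of "u.h (k + N) / u.h k"] p by simp
    also have "\<dots> \<le> v.h k / u.h k + u.h (k + N) / v.h k"
      using two_mult_le_sum_inverse_ratio[OF p] .
    finally show "2 * c * (1 + (ln (u.h (k + N)) - ln (u.h k)) / 2 - ln c) \<le> v.h k / u.h k + u.h (k + N) / v.h k"
      using p by (simp add: ln_div)
  qed
  moreover have "(\<Sum>k<L - N. 2 * c * (1 + (ln (u.h (k + N)) - ln (u.h k)) / 2 - ln c))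
     = 2 * c * ((real L - N) * (1 - ln c) + (\<Sum>k<L - N. ln (u.h (k + N)) - ln (u.h k)) / 2)"
    using LN by (simp add: sum_distrib_left[symmetric] sum.distrib sum_subtractf sum_divide_distrib[symmetric]
        of_nat_diff algebra_simps)
  \<comment> \<open>The sum telescopes to the last \<open>N\<close> minus the first \<open>N\<close>
    values of \<open>ln (u.h k)\<close>. As \<open>u.h\<close> is decreasing, the former are at
    least \<open>ln (u.h (L - 1))\<close> and the latter at most
    \<open>ln (u.h 0) = ln L\<close>.\<close>
  moreover have "(\<Sum>k<L - N. ln (u.h (k + N)) - ln (u.h k)) \<ge> 2 * N * ln (d / L)"
  proof -
    have h0: "u.h 0 = L"
    proof -
      have "u.P 0 = 1"
        using u.degree_P[of 0] u.monic_P[of 0] by (auto elim!: degree_eq_zeroE simp: one_pCons)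
      then show ?thesis
        by (simp add: u.h_def u.ip_def L_def)
    qed
    \<comment> \<open>The leading coefficient 1 is written by Lagrange interpolation, the node
      products are bounded below by \<open>d\<close>, and Cauchy-Schwarz brings in the norm.\<close>
    have hL: "u.h (L - 1) \<ge> d\<^sup>2 / L"
    proof -
      let ?p = "u.P (L - 1)"
      have "coeff ?p (L - 1) = 1" "degree ?p = L - 1"
        using u.monic_P[of "L - 1"] u.degree_P[of "L - 1"] by (auto simp: L_def)
      then have "1 = (\<Sum>x\<in>X. poly ?p x / (\<Prod>y\<in>X - {x}. x - y))"
        using lagrange_lead_coeff[of X ?p] X LN by (simp add: L_def)
      also have "\<dots> \<le> (\<Sum>x\<in>X. \<bar>poly ?p x\<bar> / d)"
      proof (rule sum_mono)
        fix x assume x: "x \<in> X"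
        have "poly ?p x / (\<Prod>y\<in>X - {x}. x - y) \<le> \<bar>poly ?p x\<bar> / (\<Prod>y\<in>X - {x}. \<bar>x - y\<bar>)"
          by (metis abs_divide abs_ge_self abs_prod)
        also have "\<dots> \<le> \<bar>poly ?p x\<bar> / d"
          using d(2)[OF x] d(1) by (intro divide_left_mono) auto
        finally show "poly ?p x / (\<Prod>y\<in>X - {x}. x - y) \<le> \<bar>poly ?p x\<bar> / d" .
      qed
      finally have "d \<le> (\<Sum>x\<in>X. \<bar>poly ?p x\<bar>)"
        using d(1) by (simp add: sum_divide_distrib[symmetric] field_simps)
      then have "d\<^sup>2 \<le> (\<Sum>x\<in>X. \<bar>poly ?p x\<bar>)\<^sup>2"
        using d(1) by (intro power_mono) auto
      also have "\<dots> \<le> (\<Sum>x\<in>X. 1\<^sup>2) * (\<Sum>x\<in>X. \<bar>poly ?p x\<bar>\<^sup>2)"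
        using Cauchy_Schwarz_ineq_sum[of "\<lambda>_. 1" "\<lambda>x. \<bar>poly ?p x\<bar>" X] by simp
      also have "\<dots> = L * u.h (L - 1)"
        by (simp add: L_def u.h_def u.ip_def power2_eq_square)
      finally show ?thesis
        using LN by (simp add: field_simps)
    qed
    have "(\<Sum>k\<in>{L - N..<L}. ln (u.h k)) \<ge> (\<Sum>k\<in>{L - N..<L}. ln (d\<^sup>2 / L))"
    proof (rule sum_mono)
      fix k assume k: "k \<in> {L - N..<L}"
      have "d\<^sup>2 / L \<le> u.h k"
        using order_trans[OF hL u.h_antimono[OF X(2), of k "L - 1"]] k by (auto simp: L_def)
      then show "ln (d\<^sup>2 / L) \<le> ln (u.h k)"
        using d(1) LN by (intro ln_mono) auto
    qed
    moreover have "(\<Sum>k<N. ln (u.h k)) \<le> (\<Sum>k<N. ln L)"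
    proof (rule sum_mono)
      fix k assume k: "k \<in> {..<N}"
      then show "ln (u.h k) \<le> ln L"
        using u.h_antimono[OF X(2), of 0 k] u.h_pos[of k] h0 LN
        by (intro ln_mono) (auto simp: L_def)
    qed
    moreover have "ln (d\<^sup>2 / L) - ln L = 2 * ln (d / L)"
      using d(1) LN by (simp add: ln_div ln_realpow)
    then have "N * ln (d\<^sup>2 / L) - N * ln L = 2 * N * ln (d / L)"
      by (simp only: right_diff_distrib[symmetric] mult.assoc)
    ultimately show ?thesis
      using LN sum_diff_shift[of N L "\<lambda>k. ln (u.h k)"] by simp
  qed
  then have "2 * c * ((real L - N) * (1 - ln c) + N * ln (d / L))
      \<le> 2 * c * ((real L - N) * (1 - ln c) + (\<Sum>k<L - N. ln (u.h (k + N)) - ln (u.h k)) / 2)"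
    using c by (intro mult_left_mono) auto
  ultimately show ?thesis
    by (simp add: L_def N_def)
qed

text \<open>Adding the constant \<open>s = e / card X\<close> makes \<open>Q\<close> strictly
  positive on the nodes and changes the sum by \<open>e\<close>; as \<open>degree Q > 0\<close>,
  degree and leading coefficient stay the same.\<close>

lemma sum_poly_ge:
  fixes Q :: "real poly" and X :: "real set"
  assumes X: "finite X" "X \<subseteq> {-1..1}" "card X > degree Q"
    and Q: "\<bar>lead_coeff Q\<bar> = 1" "\<And>x. x \<in> X \<Longrightarrow> poly Q x \<ge> 0"
    and d: "d > 0" "\<And>x. x \<in> X \<Longrightarrow> d \<le> (\<Prod>y\<in>X - {x}. \<bar>x - y\<bar>)"
    and c: "c > 0" and N: "degree Q > 0"
  shows "(\<Sum>x\<in>X. poly Q x) \<ge>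
    2 * c * ((real (card X) - degree Q) * (1 - ln c) + degree Q * ln (d / card X))"
proof (rule field_le_epsilon)
  fix e :: real assume e: "e > 0"
  define s where "s = e / card X"
  have L: "card X > 0"
    using X by simp
  have s: "s > 0"
    using e L by (simp add: s_def)
  have deg: "degree (Q + [:s:]) = degree Q"
    using N by (intro degree_add_eq_left) auto
  have lc: "coeff (Q + [:s:]) (degree Q) = lead_coeff Q"
    using N by (simp add: coeff_pCons split: nat.split)
  have "2 * c * ((real (card X) - degree Q) * (1 - ln c) + degree Q * ln (d / card X))
     \<le> (\<Sum>x\<in>X. poly (Q + [:s:]) x)"
    using sum_poly_ge_pos[of X "Q + [:s:]" d c] assms s unfolding deg lc
    by (simp add: add_nonneg_pos)
  also have "\<dots> = (\<Sum>x\<in>X. poly Q x) + e"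
    using L by (simp add: sum.distrib s_def)
  finally show "2 * c * ((real (card X) - degree Q) * (1 - ln c) + degree Q * ln (d / card X))
     \<le> (\<Sum>x\<in>X. poly Q x) + e" .
qed

section \<open>Abel regularisation of the logarithmic kernel\<close>

text \<open>Clamping to \<open>[-1, 1]\<close> makes \<open>cos (k * ang x)\<close> bounded and continuous on the whole line, while it
  agrees with the Chebyshev polynomial of degree \<open>k\<close> on \<open>[-1, 1]\<close>.\<close>
definition ang :: "real \<Rightarrow> real" where
  "ang x = arccos (max (- 1) (min 1 x))"

lemma cos_ang: "cos (ang x) = max (- 1) (min 1 x)"
  unfolding ang_def by (rule cos_arccos) auto

lemma cos_ang_eq: "x \<in> {-1..1} \<Longrightarrow> cos (ang x) = x"
  by (auto simp: cos_ang)

lemma continuous_on_ang: "continuous_on UNIV ang"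
  unfolding ang_def by (intro continuous_on_arccos continuous_intros) auto

lemma ang_measurable [measurable]: "ang \<in> borel_measurable borel"
  using continuous_on_ang by (rule borel_measurable_continuous_onI)

text \<open>The expression is \<open>|1 - r exp (i u)|^2\<close>. The third claim compares it with
  \<open>|1 - exp (i u)|^2 = 2 - 2 cos u\<close>, the difference of the two sides being
  \<open>(1 - r)^2\<close>.\<close>

lemma one_minus_two_cos_bounds:
  fixes r u :: real
  assumes "0 \<le> r" "r < 1"
  shows "0 < 1 - 2 * r * cos u + r\<^sup>2" "1 - 2 * r * cos u + r\<^sup>2 \<le> 4"
    "r * (2 - 2 * cos u) \<le> 1 - 2 * r * cos u + r\<^sup>2"
proof -
  have "0 < (1 - r)\<^sup>2"
    using assms by simp
  also have "(1 - r)\<^sup>2 \<le> 1 - 2 * r * cos u + r\<^sup>2"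
    using assms mult_left_mono[OF cos_le_one[of u], of r] by (simp add: power2_diff)
  finally show "0 < 1 - 2 * r * cos u + r\<^sup>2" .
  have "1 - 2 * r * cos u + r\<^sup>2 \<le> (1 + r)\<^sup>2"
    using assms mult_left_mono[OF cos_ge_minus_one[of u], of r] by (simp add: power2_sum)
  also have "(1 + r)\<^sup>2 \<le> 2\<^sup>2"
    using assms by (intro power_mono) auto
  finally show "1 - 2 * r * cos u + r\<^sup>2 \<le> 4"
    by simp
  have "0 \<le> (1 - r)\<^sup>2"
    by simp
  then show "r * (2 - 2 * cos u) \<le> 1 - 2 * r * cos u + r\<^sup>2"
    by (simp add: power2_diff algebra_simps)
qed

text \<open>Real part of the series of \<open>- ln (1 - z)\<close> at
  \<open>z = r exp (i u)\<close>. The term \<open>k = 0\<close> is 0 by the convention on division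
  by zero.\<close>

lemma sums_cos_power_div:
  fixes r u :: real
  assumes "0 \<le> r" "r < 1"
  shows "(\<lambda>k. r ^ k * cos (k * u) / k) sums (- (ln (1 - 2 * r * cos u + r\<^sup>2) / 2))"
proof -
  define z where "z = complex_of_real r * cis u"
  have "cmod (- z) < 1"
    using assms by (simp add: z_def norm_mult)
  then have "(\<lambda>n. - ((- (- z)) ^ n) / of_nat n) sums ln (1 + - z)"
    by (rule Ln_series')
  then have "(\<lambda>n. Re (- (z ^ n) / of_nat n)) sums Re (ln (1 - z))"
    by (intro sums_Re) simp
  moreover have "Re (- (z ^ n) / of_nat n) = - (r ^ n * cos (n * u) / n)" for n
    by (simp add: z_def power_mult_distrib Complex.DeMoivre)
  moreover have "Re (ln (1 - z)) = ln (1 - 2 * r * cos u + r\<^sup>2) / 2"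
  proof -
    have sq: "(cmod (1 - z))\<^sup>2 = 1 - 2 * r * cos u + r\<^sup>2"
    proof -
      have "(cmod (1 - z))\<^sup>2 = (1 - r * cos u)\<^sup>2 + (r * sin u)\<^sup>2"
        by (simp add: cmod_power2 z_def)
      also have "\<dots> = 1 - 2 * r * cos u + r\<^sup>2 * ((sin u)\<^sup>2 + (cos u)\<^sup>2)"
        by (simp add: power2_eq_square algebra_simps del: sin_cos_squared_add sin_cos_squared_add2 sin_cos_squared_add3)
      finally show ?thesis
        by simp
    qed
    then have pos: "cmod (1 - z) > 0"
      using one_minus_two_cos_bounds(1)[OF assms, of u] by (metis zero_less_norm_iff zero_less_power2 norm_eq_zero)
    have "Re (ln (1 - z)) = ln (cmod (1 - z))"
      using pos by (intro Re_Ln) auto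
    also have "\<dots> = ln ((cmod (1 - z))\<^sup>2) / 2"
      using pos by (simp add: ln_realpow)
    finally show ?thesis
      by (simp add: sq)
  qed
  ultimately have "(\<lambda>n. - (r ^ n * cos (n * u) / n)) sums (ln (1 - 2 * r * cos u + r\<^sup>2) / 2)"
    by (simp only:)
  then show ?thesis
    using sums_minus by fastforce
qed

text \<open>Abel regularisation of the Chebyshev expansion
  \<open>- ln (2 \<bar>cos s - cos t\<bar>) = (\<Sum>k. 2 / k * cos (k s) * cos (k t))\<close>; its closed form comes from
  \<open>4 (cos s - cos t)\<^sup>2 = \<bar>1 - exp (\<i> (s + t))\<bar>\<^sup>2 * \<bar>1 - exp (\<i> (s - t))\<bar>\<^sup>2\<close>.\<close>
definition abel_kernel :: "real \<Rightarrow> real \<Rightarrow> real \<Rightarrow> real" where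
  "abel_kernel r x y =
     - (ln (1 - 2 * r * cos (ang x + ang y) + r\<^sup>2) + ln (1 - 2 * r * cos (ang x - ang y) + r\<^sup>2)) / 2"

lemma abel_kernel_sums:
  assumes "0 \<le> r" "r < 1"
  shows "(\<lambda>k. 2 * r ^ k / k * (cos (k * ang x) * cos (k * ang y))) sums abel_kernel r x y"
proof -
  have "2 * r ^ k / k * (cos (k * ang x) * cos (k * ang y))
      = r ^ k * cos (k * (ang x + ang y)) / k + r ^ k * cos (k * (ang x - ang y)) / k" for k :: nat
    by (simp add: distrib_left right_diff_distrib cos_add cos_diff add_divide_distrib[symmetric])
  moreover have "(\<lambda>k. r ^ k * cos (k * (ang x + ang y)) / k + r ^ k * cos (k * (ang x - ang y)) / k)
      sums abel_kernel r x y"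
    using sums_add[OF sums_cos_power_div[OF assms, of "ang x + ang y"]
        sums_cos_power_div[OF assms, of "ang x - ang y"]]
    by (simp add: abel_kernel_def field_simps)
  ultimately show ?thesis
    by simp
qed

lemma abel_kernel_measurable [measurable]:
  "(\<lambda>(x, y). abel_kernel r x y) \<in> borel_measurable (borel \<Otimes>\<^sub>M borel)"
  unfolding abel_kernel_def by measurable

lemma four_sq_diff_cos:
  fixes s t :: real
  shows "(2 - 2 * cos (s + t)) * (2 - 2 * cos (s - t)) = 4 * (cos s - cos t)\<^sup>2"
proof -
  have "cos (s + t) + cos (s - t) = 2 * (cos s * cos t)"
    by (simp add: cos_add cos_diff)
  moreover have "cos (s + t) * cos (s - t) = (cos s)\<^sup>2 + (cos t)\<^sup>2 - 1"
  proof -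
    have "cos (s + t) * cos (s - t) = (cos s * cos t)\<^sup>2 - (sin s)\<^sup>2 * (sin t)\<^sup>2"
      by (simp add: cos_add cos_diff power2_eq_square algebra_simps)
    then show ?thesis
      by (simp only: sin_squared_eq) (simp add: power2_eq_square algebra_simps)
  qed
  moreover have "(2 - 2 * cos (s + t)) * (2 - 2 * cos (s - t))
      = 4 - 4 * (cos (s + t) + cos (s - t)) + 4 * (cos (s + t) * cos (s - t))"
    by (simp add: algebra_simps)
  ultimately show ?thesis
    by (simp add: power2_eq_square algebra_simps)
qed

lemma abel_kernel_ge:
  assumes "0 \<le> r" "r < 1"
  shows "- 2 * ln 2 \<le> abel_kernel r x y"
proof -
  have "ln (1 - 2 * r * cos u + r\<^sup>2) \<le> 2 * ln 2" for u
  proof -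
    have "ln (1 - 2 * r * cos u + r\<^sup>2) \<le> ln (2\<^sup>2)"
      using one_minus_two_cos_bounds[OF assms, of u] by (intro ln_mono) auto
    also have "ln (2\<^sup>2) = 2 * ln (2::real)"
      by (simp only: ln_realpow)
    finally show ?thesis .
  qed
  from this[of "ang x + ang y"] this[of "ang x - ang y"] show ?thesis
    unfolding abel_kernel_def by (simp add: field_simps)
qed

text \<open>Multiply \<open>r |1 - exp (i u)|^2 <= |1 - r exp (i u)|^2\<close> over the sum and the
  difference of the two angles. The loss \<open>- ln r\<close> vanishes as \<open>r\<close> tends to
  1.\<close>

lemma abel_kernel_le:
  assumes r: "0 < r" "r < 1" and xy: "x \<in> {-1..1}" "y \<in> {-1..1}" "x \<noteq> y"
  shows "abel_kernel r x y \<le> - ln 2 - ln r - ln \<bar>x - y\<bar>"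
proof -
  let ?a = "1 - 2 * r * cos (ang x + ang y) + r\<^sup>2" and ?b = "1 - 2 * r * cos (ang x - ang y) + r\<^sup>2"
  have pos: "?a > 0" "?b > 0"
    using one_minus_two_cos_bounds(1) r by auto
  have "(2 * r * \<bar>x - y\<bar>)\<^sup>2 = (r * (2 - 2 * cos (ang x + ang y))) * (r * (2 - 2 * cos (ang x - ang y)))"
    using four_sq_diff_cos[of "ang x" "ang y"] xy by (simp add: cos_ang_eq power2_eq_square)
  also have "\<dots> \<le> ?a * ?b"
    using one_minus_two_cos_bounds(3) r pos by (intro mult_mono) auto
  finally have "ln ((2 * r * \<bar>x - y\<bar>)\<^sup>2) \<le> ln (?a * ?b)"
    using r xy by (intro ln_mono) auto
  moreover have "ln ((2 * r * \<bar>x - y\<bar>)\<^sup>2) = 2 * (ln 2 + ln r + ln \<bar>x - y\<bar>)"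
    using r xy by (simp add: ln_realpow ln_mult)
  moreover have "ln (?a * ?b) = ln ?a + ln ?b"
    using pos by (simp add: ln_mult)
  ultimately show ?thesis
    by (simp add: abel_kernel_def)
qed

text \<open>Both factors are at least \<open>(1 - r)^2\<close>. The bound includes the diagonal,
  which makes point masses admissible.\<close>

lemma abel_kernel_bounded:
  assumes "0 \<le> r" "r < 1"
  shows "\<bar>abel_kernel r x y\<bar> \<le> 2 * ln 2 - 2 * ln (1 - r)"
proof -
  have "2 * ln (1 - r) \<le> ln (1 - 2 * r * cos u + r\<^sup>2)" for u
  proof -
    have "(1 - r)\<^sup>2 \<le> 1 - 2 * r * cos u + r\<^sup>2"
      using assms mult_left_mono[OF cos_le_one[of u], of r] by (simp add: power2_diff)
    then have "ln ((1 - r)\<^sup>2) \<le> ln (1 - 2 * r * cos u + r\<^sup>2)"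
      using assms by (intro ln_mono) auto
    then show ?thesis
      using assms by (simp add: ln_realpow)
  qed
  from this[of "ang x + ang y"] this[of "ang x - ang y"]
  have "abel_kernel r x y \<le> - 2 * ln (1 - r)"
    unfolding abel_kernel_def by (simp add: field_simps)
  moreover have "ln (1 - r) \<le> 0"
    using assms by simp
  ultimately show ?thesis
    using abel_kernel_ge[OF assms, of x y] ln_gt_zero[of 2] by linarith
qed

text \<open>A concrete sequence tending to 1, since Fatou's lemma works with sequences.\<close>

definition rad :: "nat \<Rightarrow> real" where
  "rad n = 1 - 1 / (real n + 2)"

lemma rad_bounds: "0 < rad n" "rad n < 1"
  by (auto simp: rad_def)

lemma rad_tendsto: "rad \<longlonglongrightarrow> 1"
proof -
  have "(\<lambda>n. 1 - 1 / (real n + 2)) \<longlonglongrightarrow> 1 - 0"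
    by real_asymp
  then show ?thesis
    by (simp add: rad_def[abs_def])
qed

text \<open>\<open>ln 2\<close> is the largest value of \<open>ln |x - y|\<close> on
  \<open>[-1, 1]\<close>, so \<open>ennreal\<close> truncates nothing there.\<close>

definition log_kernel :: "real \<Rightarrow> real \<Rightarrow> ennreal" where
  "log_kernel x y = (if x = y then \<infinity> else ennreal (ln 2 - ln \<bar>x - y\<bar>))"

lemma log_kernel_measurable [measurable]:
  "(\<lambda>(x, y). log_kernel x y) \<in> borel_measurable (borel \<Otimes>\<^sub>M borel)"
  unfolding log_kernel_def by measurable

lemma log_kernel_measurable2 [measurable]: "log_kernel x \<in> borel_measurable borel"
  unfolding log_kernel_def by measurable

text \<open>The diagonal is included through the convention \<open>ln 0 = 0\<close>.\<close>

lemma ln_abs_diff_le_ln2: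
  fixes x y :: real
  assumes "x \<in> {-1..1}" "y \<in> {-1..1}"
  shows "ln \<bar>x - y\<bar> \<le> ln 2"
proof (cases "x = y")
  case False
  then show ?thesis
    using assms by (intro ln_mono) auto
qed simp

text \<open>The Chebyshev series represents \<open>- ln (2 |x - y|)\<close>, so adding
  \<open>2 ln 2\<close> produces the kernel shifted by \<open>ln 2\<close>. The same constant makes
  the Abel kernel nonnegative.\<close>

lemma abel_kernel_le_log_kernel:
  assumes r: "0 < r" "r < 1" and xy: "x \<in> {-1..1}" "y \<in> {-1..1}"
  shows "ennreal (2 * ln 2 + abel_kernel r x y) \<le> log_kernel x y + ennreal (- ln r)"
proof (cases "x = y")
  case False
  have "ln \<bar>x - y\<bar> \<le> ln 2" "ln r \<le> 0"
    using r xy ln_abs_diff_le_ln2 by auto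
  then have "log_kernel x y + ennreal (- ln r) = ennreal (ln 2 - ln \<bar>x - y\<bar> - ln r)"
    using False by (simp add: log_kernel_def flip: ennreal_plus)
  then show ?thesis
    using abel_kernel_le[OF r xy False] by (simp add: ennreal_leI)
qed (simp add: log_kernel_def)

text \<open>Off the diagonal the closed form is continuous at \<open>r = 1\<close>; on the diagonal
  it diverges to infinity.\<close>

lemma log_kernel_le_liminf:
  assumes xy: "x \<in> {-1..1}" "y \<in> {-1..1}"
  shows "log_kernel x y \<le> liminf (\<lambda>n. ennreal (2 * ln 2 + abel_kernel (rad n) x y))"
proof -
  have "(\<lambda>n. ennreal (2 * ln 2 + abel_kernel (rad n) x y)) \<longlonglongrightarrow> log_kernel x y"
  proof (cases "x = y")
    case False
    let ?a = "2 - 2 * cos (ang x + ang y)" and ?b = "2 - 2 * cos (ang x - ang y)"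
    have ab: "?a * ?b = 4 * (x - y)\<^sup>2"
      using four_sq_diff_cos[of "ang x" "ang y"] xy by (simp add: cos_ang_eq)
    have "?a \<ge> 0" "?b \<ge> 0" "?a * ?b > 0"
      using False ab by simp_all
    then have pos: "?a > 0" "?b > 0"
      by (metis less_eq_real_def mult_zero_left mult_zero_right less_irrefl)+
    have "(\<lambda>n. abel_kernel (rad n) x y) \<longlonglongrightarrow>
       - (ln (1 - 2 * 1 * cos (ang x + ang y) + 1\<^sup>2) + ln (1 - 2 * 1 * cos (ang x - ang y) + 1\<^sup>2)) / 2"
      unfolding abel_kernel_def using pos by (intro tendsto_intros rad_tendsto) auto
    also have "- (ln (1 - 2 * 1 * cos (ang x + ang y) + 1\<^sup>2) + ln (1 - 2 * 1 * cos (ang x - ang y) + 1\<^sup>2)) / 2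
       = - ln (?a * ?b) / 2"
      using pos by (subst ln_mult) auto
    also have "ln (?a * ?b) = ln ((2 * \<bar>x - y\<bar>)\<^sup>2)"
      by (simp add: ab power_mult_distrib)
    also have "\<dots> = 2 * (ln 2 + ln \<bar>x - y\<bar>)"
      using False by (subst ln_realpow) (auto simp: ln_mult)
    finally have "(\<lambda>n. 2 * ln 2 + abel_kernel (rad n) x y) \<longlonglongrightarrow> 2 * ln 2 + - (2 * (ln 2 + ln \<bar>x - y\<bar>)) / 2"
      by (intro tendsto_intros)
    also have "2 * ln 2 + - (2 * (ln 2 + ln \<bar>x - y\<bar>)) / 2 = ln 2 - ln \<bar>x - y\<bar>"
      by (simp add: field_simps)
    finally show ?thesis
      using False by (simp add: log_kernel_def tendsto_ennrealI)
  next
    case True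
    have "filterlim (\<lambda>n. 2 * ln 2 + abel_kernel (rad n) x y) at_top sequentially"
    proof (rule filterlim_at_top_mono)
      show "filterlim (\<lambda>n. ln (real n + 2)) at_top sequentially"
        by real_asymp
      show "\<forall>\<^sub>F n in sequentially. ln (real n + 2) \<le> 2 * ln 2 + abel_kernel (rad n) x y"
      proof (rule always_eventually, rule allI)
        fix n
        have "ln (1 - 2 * rad n * cos (ang x + ang y) + (rad n)\<^sup>2) \<le> ln (2\<^sup>2)"
          using one_minus_two_cos_bounds[of "rad n" "ang x + ang y"] rad_bounds[of n]
          by (intro ln_mono) auto
        moreover have "ln (2\<^sup>2) = 2 * ln (2::real)"
          by (simp only: ln_realpow)
        \<comment> \<open>Here the difference of angles is 0 and the factor is
          \<open>(1 - rad n)^2\<close>, the source of the divergence.\<close>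
        moreover have "1 - 2 * rad n * cos (ang x - ang y) + (rad n)\<^sup>2 = (1 / (real n + 2))\<^sup>2"
          using True by (simp add: rad_def power2_eq_square algebra_simps)
        moreover have "ln ((1 / (real n + 2))\<^sup>2) = - 2 * ln (real n + 2)"
          by (simp add: ln_realpow ln_div power_divide)
        ultimately have "ln (1 - 2 * rad n * cos (ang x + ang y) + (rad n)\<^sup>2)
            + ln (1 - 2 * rad n * cos (ang x - ang y) + (rad n)\<^sup>2) \<le> 2 * ln 2 - 2 * ln (real n + 2)"
          by simp
        moreover have "2 * abel_kernel (rad n) x y = - (ln (1 - 2 * rad n * cos (ang x + ang y) + (rad n)\<^sup>2)
            + ln (1 - 2 * rad n * cos (ang x - ang y) + (rad n)\<^sup>2))"
          unfolding abel_kernel_def by simp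
        ultimately show "ln (real n + 2) \<le> 2 * ln 2 + abel_kernel (rad n) x y"
          using ln_gt_zero[of 2] by linarith
      qed
    qed
    then show ?thesis
      using True by (simp add: log_kernel_def ennreal_tendsto_top_eq_at_top)
  qed
  then show ?thesis
    using lim_imp_Liminf[of sequentially] by fastforce
qed

section \<open>Energy in terms of Chebyshev coefficients\<close>

lemma (in prob_space) integrable_bounded_measurable:
  fixes f :: "'a \<Rightarrow> real"
  assumes "f \<in> borel_measurable M" "\<And>x. \<bar>f x\<bar> \<le> B"
  shows "integrable M f"
  by (rule integrable_const_bound[where B = B]) (use assms in auto)

definition cheb_coeff :: "nat \<Rightarrow> real measure \<Rightarrow> real" where
  "cheb_coeff k M = (\<integral>x. cos (k * ang x) \<partial>M)"

definition abel_energy :: "real \<Rightarrow> real measure \<Rightarrow> real" where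
  "abel_energy r M = (\<Sum>k. 2 * r ^ k / k * (cheb_coeff k M)\<^sup>2)"

definition kernel_energy :: "real measure \<Rightarrow> ennreal" where
  "kernel_energy M = (\<integral>\<^sup>+x. \<integral>\<^sup>+y. log_kernel x y \<partial>M \<partial>M)"

lemma summable_geometric_coeff:
  fixes r :: real
  assumes "0 \<le> r" "r < 1"
  shows "summable (\<lambda>k. 2 * r ^ k / real k)"
proof (rule summable_comparison_test')
  show "summable (\<lambda>k. 2 * r ^ k)"
    using assms by (intro summable_mult summable_geometric) auto
  show "norm (2 * r ^ k / real k) \<le> 2 * r ^ k" for k
    using assms zero_le_power[of r k]
    by (cases k) (auto simp: divide_le_eq mult_le_cancel_left1 simp del: power_Suc zero_le_power)
qed

locale interval_distribution = real_distribution +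
  assumes AE_interval: "AE x in M. x \<in> {-1..1}"
begin

lemma measure_UNIV_1 [simp]: "prob UNIV = 1" "emeasure M UNIV = 1"
  using prob_space emeasure_space_1 by simp_all

lemma borel_measurable_eq: "borel_measurable M = borel_measurable borel"
  by (intro measurable_cong_sets) auto

lemma borel_measurable_pair_eq: "borel_measurable (M \<Otimes>\<^sub>M M) = borel_measurable (borel \<Otimes>\<^sub>M borel)"
  by (intro measurable_cong_sets sets_pair_measure_cong) auto

lemma integrable_cos_ang: "integrable M (\<lambda>x. cos (real k * ang x))"
  by (rule integrable_bounded_measurable[where B = 1]) auto

lemma cheb_coeff_bounded: "\<bar>cheb_coeff k M\<bar> \<le> 1"
proof -
  have "\<bar>\<integral>x. cos (real k * ang x) \<partial>M\<bar> \<le> (\<integral>x. \<bar>cos (real k * ang x)\<bar> \<partial>M)"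
    by (rule integral_abs_bound)
  also have "\<dots> \<le> (\<integral>x. 1 \<partial>M)"
    by (intro integral_mono integrable_abs integrable_cos_ang) auto
  finally show ?thesis
    by (simp add: cheb_coeff_def prob_space)
qed

lemma summable_abel_energy:
  assumes "0 \<le> r" "r < 1"
  shows "summable (\<lambda>k. 2 * r ^ k / k * (cheb_coeff k M)\<^sup>2)"
proof (rule summable_comparison_test'[OF summable_geometric_coeff[OF assms]])
  fix k
  have "(cheb_coeff k M)\<^sup>2 \<le> 1"
    using cheb_coeff_bounded[of k] by (simp add: abs_square_le_1)
  then show "norm (2 * r ^ k / k * (cheb_coeff k M)\<^sup>2) \<le> 2 * r ^ k / k"
    using assms mult_left_mono[of "(cheb_coeff k M)\<^sup>2" 1 "2 * r ^ k / k"] by simp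
qed

text \<open>For \<open>r < 1\<close> the terms are dominated by the summable
  \<open>2 r^k / k\<close>, uniformly in both variables, so the series may be integrated
  termwise.\<close>

lemma integral_abel_kernel_sums:
  assumes "0 \<le> r" "r < 1"
  shows "(\<lambda>k. 2 * r ^ k / k * (cos (k * ang x) * cheb_coeff k M)) sums (\<integral>y. abel_kernel r x y \<partial>M)"
proof -
  let ?f = "\<lambda>k y. 2 * r ^ k / real k * (cos (k * ang x) * cos (k * ang y))"
  have bound: "norm (?f k y) \<le> 2 * r ^ k / real k" for k y
  proof -
    have "\<bar>cos (k * ang x) * cos (k * ang y)\<bar> \<le> 1"
      by (simp add: abs_mult mult_le_one)
    then have "2 * r ^ k / real k * \<bar>cos (k * ang x) * cos (k * ang y)\<bar> \<le> 2 * r ^ k / real k * 1"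
      using assms by (intro mult_left_mono) auto
    then show ?thesis
      using assms by (simp add: abs_mult)
  qed
  have int: "integrable M (?f k)" for k
    by (rule integrable_bounded_measurable[where B = "2 * r ^ k / real k"]) (use bound in auto)
  have "(\<lambda>k. \<integral>y. ?f k y \<partial>M) sums (\<integral>y. (\<Sum>k. ?f k y) \<partial>M)"
  proof (rule sums_integral[OF int])
    show "AE y in M. summable (\<lambda>k. norm (?f k y))"
      by (rule AE_I2, rule summable_comparison_test'[OF summable_geometric_coeff[OF assms]])
         (use bound in auto)
    show "summable (\<lambda>k. \<integral>y. norm (?f k y) \<partial>M)"
    proof (rule summable_comparison_test'[OF summable_geometric_coeff[OF assms]])
      fix k
      have "(\<integral>y. norm (?f k y) \<partial>M) \<le> (\<integral>y. 2 * r ^ k / real k \<partial>M)"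
        by (intro integral_mono integrable_norm int) (use bound in auto)
      then show "norm (\<integral>y. norm (?f k y) \<partial>M) \<le> 2 * r ^ k / real k"
        by simp
    qed
  qed
  moreover have "(\<Sum>k. ?f k y) = abel_kernel r x y" for y
    using abel_kernel_sums[OF assms] by (rule sums_unique[symmetric])
  ultimately show ?thesis
    by (simp add: cheb_coeff_def)
qed

lemma integral_integral_abel_kernel:
  assumes "0 \<le> r" "r < 1"
  shows "(\<integral>x. \<integral>y. abel_kernel r x y \<partial>M \<partial>M) = abel_energy r M"
proof -
  let ?f = "\<lambda>k x. 2 * r ^ k / real k * (cos (k * ang x) * cheb_coeff k M)"
  have bound: "norm (?f k x) \<le> 2 * r ^ k / real k" for k x
  proof -
    have "\<bar>cos (k * ang x) * cheb_coeff k M\<bar> \<le> 1"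
      using cheb_coeff_bounded[of k] by (simp add: abs_mult mult_le_one)
    then have "2 * r ^ k / real k * \<bar>cos (k * ang x) * cheb_coeff k M\<bar> \<le> 2 * r ^ k / real k * 1"
      using assms by (intro mult_left_mono) auto
    then show ?thesis
      using assms by (simp add: abs_mult)
  qed
  have int: "integrable M (?f k)" for k
    by (rule integrable_bounded_measurable[where B = "2 * r ^ k / real k"]) (use bound in auto)
  have "(\<lambda>k. \<integral>x. ?f k x \<partial>M) sums (\<integral>x. (\<Sum>k. ?f k x) \<partial>M)"
  proof (rule sums_integral[OF int])
    show "AE x in M. summable (\<lambda>k. norm (?f k x))"
      by (rule AE_I2, rule summable_comparison_test'[OF summable_geometric_coeff[OF assms]])
         (use bound in auto)
    show "summable (\<lambda>k. \<integral>x. norm (?f k x) \<partial>M)"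
    proof (rule summable_comparison_test'[OF summable_geometric_coeff[OF assms]])
      fix k
      have "(\<integral>x. norm (?f k x) \<partial>M) \<le> (\<integral>x. 2 * r ^ k / real k \<partial>M)"
        by (intro integral_mono integrable_norm int) (use bound in auto)
      then show "norm (\<integral>x. norm (?f k x) \<partial>M) \<le> 2 * r ^ k / real k"
        by simp
    qed
  qed
  moreover have "(\<Sum>k. ?f k x) = (\<integral>y. abel_kernel r x y \<partial>M)" for x
    using integral_abel_kernel_sums[OF assms] by (rule sums_unique[symmetric])
  moreover have "(\<integral>x. ?f k x \<partial>M) = 2 * r ^ k / k * (cheb_coeff k M)\<^sup>2" for k
    by (simp add: cheb_coeff_def power2_eq_square)
  ultimately have "(\<lambda>k. 2 * r ^ k / k * (cheb_coeff k M)\<^sup>2) sums (\<integral>x. \<integral>y. abel_kernel r x y \<partial>M \<partial>M)"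
    by (simp only:)
  then show ?thesis
    unfolding abel_energy_def by (rule sums_unique)
qed

lemma nn_integral_abel_kernel:
  assumes r: "0 \<le> r" "r < 1"
  shows "(\<integral>\<^sup>+x. \<integral>\<^sup>+y. ennreal (2 * ln 2 + abel_kernel r x y) \<partial>M \<partial>M) = ennreal (2 * ln 2 + abel_energy r M)"
proof -
  let ?B = "2 * ln 2 - 2 * ln (1 - r)"
  have mk [measurable]: "(\<lambda>(x, y). abel_kernel r x y) \<in> borel_measurable (M \<Otimes>\<^sub>M M)"
    using abel_kernel_measurable[of r] by (simp only: borel_measurable_pair_eq)
  have mkx [measurable]: "abel_kernel r x \<in> borel_measurable M" for x
    unfolding abel_kernel_def by measurable
  have intx: "integrable M (abel_kernel r x)" for x
    by (rule integrable_bounded_measurable[where B = ?B]) (use abel_kernel_bounded[OF r] in auto)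
  have nonneg: "0 \<le> 2 * ln 2 + abel_kernel r x y" for x y
    using abel_kernel_ge[OF r, of x y] by simp
  have inner: "(\<integral>\<^sup>+y. ennreal (2 * ln 2 + abel_kernel r x y) \<partial>M) = ennreal (2 * ln 2 + (\<integral>y. abel_kernel r x y \<partial>M))" for x
    using intx by (subst nn_integral_eq_integral) (auto simp: nonneg prob_space)
  have int2: "integrable M (\<lambda>x. \<integral>y. abel_kernel r x y \<partial>M)"
  proof (rule integrable_bounded_measurable[where B = ?B])
    show "(\<lambda>x. \<integral>y. abel_kernel r x y \<partial>M) \<in> borel_measurable M"
      by (intro borel_measurable_lebesgue_integral) (use mk in auto)
    fix x
    have "\<bar>\<integral>y. abel_kernel r x y \<partial>M\<bar> \<le> (\<integral>y. \<bar>abel_kernel r x y\<bar> \<partial>M)"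
      by (rule integral_abs_bound)
    also have "\<dots> \<le> (\<integral>y. ?B \<partial>M)"
      by (intro integral_mono integrable_abs intx) (use abel_kernel_bounded[OF r] in auto)
    finally show "\<bar>\<integral>y. abel_kernel r x y \<partial>M\<bar> \<le> ?B"
      by (simp add: prob_space)
  qed
  have "0 \<le> 2 * ln 2 + (\<integral>y. abel_kernel r x y \<partial>M)" for x
  proof -
    have "0 \<le> (\<integral>y. 2 * ln 2 + abel_kernel r x y \<partial>M)"
      by (rule integral_nonneg_AE) (use nonneg in auto)
    then show ?thesis
      using intx by (simp add: prob_space)
  qed
  then have "(\<integral>\<^sup>+x. ennreal (2 * ln 2 + (\<integral>y. abel_kernel r x y \<partial>M)) \<partial>M) = ennreal (2 * ln 2 + abel_energy r M)"
    using int2 by (subst nn_integral_eq_integral) (auto simp: prob_space integral_integral_abel_kernel[OF r])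
  then show ?thesis
    by (simp add: inner)
qed

lemma abel_energy_nonneg: "0 \<le> r \<Longrightarrow> r < 1 \<Longrightarrow> 0 \<le> abel_energy r M"
  unfolding abel_energy_def by (intro suminf_nonneg summable_abel_energy) auto

lemma abel_energy_le:
  assumes r: "0 < r" "r < 1"
  shows "ennreal (2 * ln 2 + abel_energy r M) \<le> kernel_energy M + ennreal (- ln r)"
proof -
  have "ennreal (2 * ln 2 + abel_energy r M) = (\<integral>\<^sup>+x. \<integral>\<^sup>+y. ennreal (2 * ln 2 + abel_kernel r x y) \<partial>M \<partial>M)"
    using r by (subst nn_integral_abel_kernel) auto
  also have "\<dots> \<le> (\<integral>\<^sup>+x. \<integral>\<^sup>+y. log_kernel x y + ennreal (- ln r) \<partial>M \<partial>M)"
  proof (rule nn_integral_mono_AE, rule AE_mp[OF AE_interval], rule AE_I2, rule impI)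
    fix x :: real assume x: "x \<in> {-1..1}"
    show "(\<integral>\<^sup>+y. ennreal (2 * ln 2 + abel_kernel r x y) \<partial>M) \<le> (\<integral>\<^sup>+y. log_kernel x y + ennreal (- ln r) \<partial>M)"
      by (rule nn_integral_mono_AE, rule AE_mp[OF AE_interval], rule AE_I2)
         (use abel_kernel_le_log_kernel[OF r x] in auto)
  qed
  also have "\<dots> = (\<integral>\<^sup>+x. (\<integral>\<^sup>+y. log_kernel x y \<partial>M) + ennreal (- ln r) \<partial>M)"
    by (subst nn_integral_add) (auto simp: emeasure_space_1)
  also have "\<dots> = kernel_energy M + ennreal (- ln r)"
  proof -
    have "(\<lambda>x. \<integral>\<^sup>+y. log_kernel x y \<partial>M) \<in> borel_measurable M"
      by (intro borel_measurable_nn_integral)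
         (use log_kernel_measurable in \<open>simp only: borel_measurable_pair_eq\<close>)
    then show ?thesis
      unfolding kernel_energy_def by (subst nn_integral_add) (auto simp: emeasure_space_1)
  qed
  finally show ?thesis .
qed

text \<open>Fatou's lemma in each variable. Together with \<open>abel_energy_le\<close> it recovers
  the energy from the regularised energies, also when it is infinite.\<close>

lemma kernel_energy_le_liminf:
  "kernel_energy M \<le> liminf (\<lambda>n. ennreal (2 * ln 2 + abel_energy (rad n) M))"
proof -
  let ?k = "\<lambda>n x y. ennreal (2 * ln 2 + abel_kernel (rad n) x y)"
  have "kernel_energy M \<le> (\<integral>\<^sup>+x. \<integral>\<^sup>+y. liminf (\<lambda>n. ?k n x y) \<partial>M \<partial>M)"
    unfolding kernel_energy_def
  proof (rule nn_integral_mono_AE, rule AE_mp[OF AE_interval], rule AE_I2, rule impI)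
    fix x :: real assume x: "x \<in> {-1..1}"
    show "(\<integral>\<^sup>+y. log_kernel x y \<partial>M) \<le> (\<integral>\<^sup>+y. liminf (\<lambda>n. ?k n x y) \<partial>M)"
      by (rule nn_integral_mono_AE, rule AE_mp[OF AE_interval], rule AE_I2)
         (use log_kernel_le_liminf[OF x] in auto)
  qed
  also have "\<dots> \<le> (\<integral>\<^sup>+x. liminf (\<lambda>n. \<integral>\<^sup>+y. ?k n x y \<partial>M) \<partial>M)"
    by (intro nn_integral_mono nn_integral_liminf) (simp add: abel_kernel_def)
  also have "\<dots> \<le> liminf (\<lambda>n. \<integral>\<^sup>+x. \<integral>\<^sup>+y. ?k n x y \<partial>M \<partial>M)"
  proof (rule nn_integral_liminf, rule borel_measurable_nn_integral)
    fix n
    have "(\<lambda>(x, y). ?k n x y) \<in> borel_measurable (borel \<Otimes>\<^sub>M borel)"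
      using abel_kernel_measurable[of "rad n"] by measurable
    then show "(\<lambda>(x, y). ?k n x y) \<in> borel_measurable (M \<Otimes>\<^sub>M M)"
      by (simp only: borel_measurable_pair_eq)
  qed
  also have "\<dots> = liminf (\<lambda>n. ennreal (2 * ln 2 + abel_energy (rad n) M))"
    using rad_bounds by (subst nn_integral_abel_kernel) (auto simp: less_imp_le)
  finally show ?thesis .
qed

lemma kernel_energy_le_lim:
  assumes "\<And>n. 2 * ln 2 + abel_energy (rad n) M \<le> b n" "b \<longlonglongrightarrow> v"
  shows "kernel_energy M \<le> ennreal v"
proof -
  have "liminf (\<lambda>n. ennreal (b n)) = ennreal v"
    using assms(2) by (intro lim_imp_Liminf tendsto_ennrealI) auto
  moreover have "liminf (\<lambda>n. ennreal (2 * ln 2 + abel_energy (rad n) M)) \<le> liminf (\<lambda>n. ennreal (b n))"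
    using assms(1) by (intro Liminf_mono always_eventually allI ennreal_leI)
  ultimately show ?thesis
    using kernel_energy_le_liminf by simp
qed

end

section \<open>Relation to the logarithmic energy\<close>

lemma prob_measures_on_imp:
  assumes "M \<in> prob_measures_on K" "closed K"
  shows "real_distribution M" "AE x in M. x \<in> K"
proof -
  have *: "emeasure M UNIV = 1" "sets M = sets borel" "emeasure M (UNIV - K) = 0"
    using assms by (auto simp: prob_measures_on_def)
  have sp: "space M = UNIV"
    using sets_eq_imp_space_eq[OF *(2)] by simp
  show "real_distribution M"
    by (intro real_distribution.intro real_distribution_axioms.intro prob_spaceI) (use * sp in auto)
  show "AE x in M. x \<in> K"
    by (rule AE_I[of _ _ "UNIV - K"]) (use * sp assms in auto)
qed

lemma prob_measures_on_interval:
  assumes "M \<in> prob_measures_on K" "closed K" "K \<subseteq> {-1..1}"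
  shows "interval_distribution M"
proof (intro interval_distribution.intro interval_distribution_axioms.intro)
  show "real_distribution M"
    using assms(1,2) by (rule prob_measures_on_imp)
  show "AE x in M. x \<in> {-1..1}"
    by (rule AE_mp[OF prob_measures_on_imp(2)[OF assms(1,2)]], rule AE_I2) (use assms(3) in auto)
qed

lemma prob_measures_onI:
  assumes "real_distribution M" "AE x in M. x \<in> K" "closed K"
  shows "M \<in> prob_measures_on K"
proof -
  interpret real_distribution M by fact
  have "UNIV - K \<in> sets M"
    using assms by simp
  then have "emeasure M (UNIV - K) = 0"
    using assms(2) by (subst (asm) AE_iff_measurable[of "UNIV - K"]) auto
  then show ?thesis
    using emeasure_space_1 by (auto simp: prob_measures_on_def)
qed

context interval_distribution
begin

text \<open>The subtraction inside \<open>log_energy\<close> is harmless because the part with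
  \<open>|x - y| > 1\<close> contributes at most \<open>ln 2\<close>.\<close>

lemma kernel_energy_log_energy: "log_energy M = enn2ereal (kernel_energy M) - ereal (ln 2)"
proof -
  define p where "p x y = (if x = y then \<infinity> else ennreal (- ln \<bar>x - y\<bar>))" for x y :: real
  define q where "q x y = (if x = y then 0 else ennreal (ln \<bar>x - y\<bar>))" for x y :: real
  have mp: "(\<lambda>(x, y). p x y) \<in> borel_measurable (M \<Otimes>\<^sub>M M)" "p x \<in> borel_measurable M" for x
    unfolding p_def borel_measurable_pair_eq by measurable
  have mq: "(\<lambda>(x, y). q x y) \<in> borel_measurable (M \<Otimes>\<^sub>M M)" "q x \<in> borel_measurable M" for x
    unfolding q_def borel_measurable_pair_eq by measurable
  have mk: "(\<lambda>(x, y). log_kernel x y) \<in> borel_measurable (M \<Otimes>\<^sub>M M)"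
    unfolding borel_measurable_pair_eq by measurable
  note m2 = borel_measurable_nn_integral[OF mp(1)] borel_measurable_nn_integral[OF mq(1)]
    borel_measurable_nn_integral[OF mk]
  \<comment> \<open>Stated additively, since subtraction of extended nonnegative reals
    truncates.\<close>
  have pt: "log_kernel x y + q x y = p x y + ennreal (ln 2)" if "x \<in> {-1..1}" "y \<in> {-1..1}" for x y
  proof (cases "x = y")
    case False
    have "ln \<bar>x - y\<bar> \<le> ln 2"
      using that by (rule ln_abs_diff_le_ln2)
    then show ?thesis
      using False by (cases "ln \<bar>x - y\<bar> \<ge> 0")
        (auto simp: log_kernel_def p_def q_def ennreal_neg simp flip: ennreal_plus)
  qed (simp add: log_kernel_def p_def q_def)
  have ae: "AE x in M. (\<integral>\<^sup>+y. log_kernel x y \<partial>M) + (\<integral>\<^sup>+y. q x y \<partial>M) = (\<integral>\<^sup>+y. p x y \<partial>M) + ennreal (ln 2)"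
  proof (rule AE_mp[OF AE_interval], rule AE_I2, rule impI)
    fix x :: real assume x: "x \<in> {-1..1}"
    have "(\<integral>\<^sup>+y. log_kernel x y \<partial>M) + (\<integral>\<^sup>+y. q x y \<partial>M) = (\<integral>\<^sup>+y. log_kernel x y + q x y \<partial>M)"
      using mq by (subst nn_integral_add) auto
    also have "\<dots> = (\<integral>\<^sup>+y. p x y + ennreal (ln 2) \<partial>M)"
      by (rule nn_integral_cong_AE, rule AE_mp[OF AE_interval], rule AE_I2) (use pt x in auto)
    also have "\<dots> = (\<integral>\<^sup>+y. p x y \<partial>M) + ennreal (ln 2)"
      using mp by (subst nn_integral_add) auto
    finally show "(\<integral>\<^sup>+y. log_kernel x y \<partial>M) + (\<integral>\<^sup>+y. q x y \<partial>M) = (\<integral>\<^sup>+y. p x y \<partial>M) + ennreal (ln 2)" .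
  qed
  let ?P = "\<integral>\<^sup>+x. \<integral>\<^sup>+y. p x y \<partial>M \<partial>M" and ?Q = "\<integral>\<^sup>+x. \<integral>\<^sup>+y. q x y \<partial>M \<partial>M"
  have "kernel_energy M + ?Q = (\<integral>\<^sup>+x. (\<integral>\<^sup>+y. log_kernel x y \<partial>M) + (\<integral>\<^sup>+y. q x y \<partial>M) \<partial>M)"
    unfolding kernel_energy_def using m2 by (subst nn_integral_add) auto
  also have "\<dots> = (\<integral>\<^sup>+x. (\<integral>\<^sup>+y. p x y \<partial>M) + ennreal (ln 2) \<partial>M)"
    by (rule nn_integral_cong_AE[OF ae])
  also have "\<dots> = ?P + ennreal (ln 2)"
    using m2 by (subst nn_integral_add) auto
  finally have eq: "kernel_energy M + ?Q = ?P + ennreal (ln 2)" .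
  have "?Q \<le> (\<integral>\<^sup>+x. \<integral>\<^sup>+y. ennreal (ln 2) \<partial>M \<partial>M)"
  proof (rule nn_integral_mono_AE, rule AE_mp[OF AE_interval], rule AE_I2, rule impI)
    fix x :: real assume x: "x \<in> {-1..1}"
    show "(\<integral>\<^sup>+y. q x y \<partial>M) \<le> (\<integral>\<^sup>+y. ennreal (ln 2) \<partial>M)"
      by (rule nn_integral_mono_AE, rule AE_mp[OF AE_interval], rule AE_I2)
         (use ln_abs_diff_le_ln2[OF x] in \<open>auto simp: q_def simp del: ln_le_cancel_iff intro!: ennreal_leI\<close>)
  qed
  also have "\<dots> = ennreal (ln 2)"
    by simp
  finally have "?Q < \<infinity>"
    by (metis ennreal_less_top infinity_ennreal_def order_le_less_trans)
  then obtain c where c: "?Q = ennreal c" "c \<ge> 0"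
    by (cases "?Q") auto
  have "log_energy M = enn2ereal ?P - enn2ereal ?Q"
    by (simp add: log_energy_def p_def q_def)
  also have "\<dots> = enn2ereal (kernel_energy M) - ereal (ln 2)"
  proof (cases ?P)
    case (real a)
    then have "kernel_energy M + ennreal c = ennreal (a + ln 2)"
      using eq c by simp
    then obtain b where b: "kernel_energy M = ennreal b" "b \<ge> 0"
      by (cases "kernel_energy M") auto
    then have "b + c = a + ln 2"
      using eq c real by (simp flip: ennreal_plus)
    then show ?thesis
      using b c real by (simp add: enn2ereal_ennreal)
  next
    case top
    then have "kernel_energy M = top"
      using eq c by (cases "kernel_energy M") (auto simp flip: ennreal_plus)
    then show ?thesis
      using top c by (simp add: enn2ereal_ennreal)
  qed
  finally show ?thesis .
qed

text \<open>At \<open>r = 1 / 2\<close> the Abel energy is nonnegative, and the loss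
  \<open>- ln (1 / 2) = ln 2\<close> is taken from \<open>2 ln 2\<close>. This is what makes the
  Robin constant nonnegative.\<close>

lemma kernel_energy_ge: "kernel_energy M \<ge> ennreal (ln 2)"
proof -
  have "ennreal (2 * ln 2) \<le> ennreal (2 * ln 2 + abel_energy (1 / 2) M)"
    using abel_energy_nonneg[of "1 / 2"] by (intro ennreal_leI) auto
  also have "\<dots> \<le> kernel_energy M + ennreal (- ln (1 / 2))"
    by (rule abel_energy_le) auto
  also have "- ln (1 / 2) = ln (2 :: real)"
    by (simp add: ln_div)
  finally have "ennreal (ln 2) + ennreal (ln 2) \<le> kernel_energy M + ennreal (ln 2)"
    by (simp flip: ennreal_plus)
  then show ?thesis
    by (simp add: ennreal_add_left_cancel_le add.commute[of "kernel_energy M"])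
qed

end

text \<open>The extra factor \<open>cos (k * ang x)\<close> closes the induction on
  \<open>m\<close>, because \<open>2 cos t cos (k t) = cos ((k + 1) t) + cos ((k - 1) t)\<close>. At
  \<open>k = 0\<close> it gives the moments.\<close>

lemma interval_distribution_moments_eq:
  assumes M1: "interval_distribution M1" and M2: "interval_distribution M2"
    and c: "\<And>k. cheb_coeff k M1 = cheb_coeff k M2"
  shows "(\<integral>x. (cos (ang x)) ^ m * cos (real k * ang x) \<partial>M1) = (\<integral>x. (cos (ang x)) ^ m * cos (real k * ang x) \<partial>M2)"
proof (induction m arbitrary: k)
  case 0
  then show ?case
    using c[of k] by (simp add: cheb_coeff_def)
next
  case (Suc m)
  have int: "integrable M (\<lambda>x. (cos (ang x)) ^ m * cos (real k * ang x))"
    if "interval_distribution M" for M k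
  proof -
    interpret interval_distribution M by fact
    show ?thesis
      by (rule integrable_bounded_measurable[where B = 1])
         (auto simp: abs_mult power_abs intro!: mult_le_one power_le_one)
  qed
  show ?case
  proof (cases k)
    case 0
    then show ?thesis
      using Suc[of 1] by (simp add: mult.commute)
  next
    case k: (Suc j)
    have eq: "(cos t) ^ Suc m * cos (real k * t)
        = ((cos t) ^ m * cos (real (Suc k) * t) + (cos t) ^ m * cos (real j * t)) / 2" for t
    proof -
      have "real (Suc k) * t = real k * t + t" "real j * t = real k * t - t"
        by (simp_all add: k algebra_simps)
      then have "cos (real (Suc k) * t) + cos (real j * t) = 2 * (cos t * cos (real k * t))"
        by (simp only: cos_add cos_diff) simp
      then show ?thesis
        by (simp only: distrib_left[symmetric]) simp
    qed
    show ?thesis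
      unfolding eq using int[OF M1] int[OF M2] Suc[of "Suc k"] Suc[of j]
      by (simp del: of_nat_Suc)
  qed
qed

text \<open>Equality of moments settles polynomials, and Weierstrass approximation on
  \<open>[-1, 1]\<close> extends it to continuous \<open>f\<close>.\<close>

lemma interval_distribution_integral_eq:
  fixes f :: "real \<Rightarrow> real"
  assumes M1: "interval_distribution M1" and M2: "interval_distribution M2"
    and c: "\<And>k. cheb_coeff k M1 = cheb_coeff k M2"
    and f: "continuous_on {-1..1} f"
  shows "(\<integral>x. f (cos (ang x)) \<partial>M1) = (\<integral>x. f (cos (ang x)) \<partial>M2)"
proof -
  have bounded: "\<exists>B. \<forall>x. \<bar>g (cos (ang x))\<bar> \<le> B" if "continuous_on {-1..1} g" for g :: "real \<Rightarrow> real"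
  proof -
    have "bounded (g ` {-1..1})"
      using that compact_continuous_image compact_imp_bounded compact_Icc by blast
    then obtain B where "\<forall>y\<in>g ` {-1..1}. norm y \<le> B"
      unfolding bounded_iff by blast
    then show ?thesis
      by (intro exI[of _ B]) auto
  qed
  have int: "integrable M (\<lambda>x. g (cos (ang x)))"
    if "interval_distribution M" and g: "continuous_on {-1..1} g" for M and g :: "real \<Rightarrow> real"
  proof -
    interpret interval_distribution M by fact
    obtain B where "\<And>x. \<bar>g (cos (ang x))\<bar> \<le> B"
      using bounded[OF g] by blast
    moreover have "continuous_on UNIV (\<lambda>x. g (cos (ang x)))"
      by (rule continuous_on_compose2[OF g]) (auto intro!: continuous_intros continuous_on_ang)
    then have "(\<lambda>x. g (cos (ang x))) \<in> borel_measurable M"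
      using borel_measurable_continuous_onI by (simp only: borel_measurable_eq)
    ultimately show ?thesis
      by (intro integrable_bounded_measurable)
  qed
  have "\<bar>(\<integral>x. f (cos (ang x)) \<partial>M1) - (\<integral>x. f (cos (ang x)) \<partial>M2)\<bar> \<le> e" if e: "e > 0" for e
  proof -
    obtain g where g: "real_polynomial_function g" "\<And>x. x \<in> {-1..1} \<Longrightarrow> \<bar>f x - g x\<bar> < e / 2"
      using Stone_Weierstrass_real_polynomial_function[OF compact_Icc f, of "e / 2"] e by auto
    then obtain a n where ga: "g = (\<lambda>x. \<Sum>i\<le>n. a i * x ^ i)"
      unfolding real_polynomial_function_iff_sum by blast
    have gc: "continuous_on {-1..1} g"
      unfolding ga by (intro continuous_intros)
    have close: "\<bar>(\<integral>x. f (cos (ang x)) \<partial>M) - (\<integral>x. g (cos (ang x)) \<partial>M)\<bar> \<le> e / 2"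
      if M: "interval_distribution M" for M
    proof -
      interpret interval_distribution M by fact
      have "\<bar>\<integral>x. f (cos (ang x)) - g (cos (ang x)) \<partial>M\<bar> \<le> (\<integral>x. \<bar>f (cos (ang x)) - g (cos (ang x))\<bar> \<partial>M)"
        by (rule integral_abs_bound)
      also have "\<dots> \<le> (\<integral>x. e / 2 \<partial>M)"
        by (intro integral_mono integrable_abs Bochner_Integration.integrable_diff int M f gc)
           (use g(2) in \<open>auto simp: less_imp_le\<close>)
      finally show ?thesis
        using int[OF M f] int[OF M gc] by simp
    qed
    have "(\<integral>x. g (cos (ang x)) \<partial>M1) = (\<integral>x. g (cos (ang x)) \<partial>M2)"
    proof -
      have "integrable M (\<lambda>x. cos (ang x) ^ i)" if "interval_distribution M" for M i
        using int[OF that, of "\<lambda>x. x ^ i"] by (simp add: continuous_intros)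
      then show ?thesis
        unfolding ga using M1 M2 interval_distribution_moments_eq[OF M1 M2 c, of _ 0] by simp
    qed
    then show ?thesis
      using close[OF M1] close[OF M2] by linarith
  qed
  then have "\<bar>(\<integral>x. f (cos (ang x)) \<partial>M1) - (\<integral>x. f (cos (ang x)) \<partial>M2)\<bar> \<le> 0"
    by (rule field_le_epsilon) auto
  then show ?thesis
    by simp
qed

text \<open>Almost surely \<open>x = cos (ang x)\<close>, so characteristic functions are integrals
  of continuous functions of \<open>cos (ang x)\<close>, and Levy's uniqueness theorem
  applies.\<close>

lemma interval_distribution_eqI:
  assumes M1: "interval_distribution M1" and M2: "interval_distribution M2"
    and c: "\<And>k. cheb_coeff k M1 = cheb_coeff k M2"
  shows "M1 = M2"
proof (rule Levy_uniqueness)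
  interpret M1: interval_distribution M1 by fact
  interpret M2: interval_distribution M2 by fact
  show "real_distribution M1" "real_distribution M2"
    by unfold_locales
  show "char M1 = char M2"
  proof
    fix t :: real
    have rep: "char M t = Complex (\<integral>x. cos (t * cos (ang x)) \<partial>M) (\<integral>x. sin (t * cos (ang x)) \<partial>M)"
      if "interval_distribution M" for M
    proof -
      interpret interval_distribution M by fact
      have "char M t = (\<integral>x. iexp (t * cos (ang x)) \<partial>M)"
        unfolding char_def
        by (rule integral_cong_AE, measurable, rule AE_mp[OF AE_interval], rule AE_I2) (auto simp: cos_ang_eq)
      moreover have "integrable M (\<lambda>x. iexp (t * cos (ang x)))"
        by (rule integrable_const_bound[where B = 1]) auto
      ultimately show ?thesis
        by (simp add: complex_eq_iff flip: integral_Re integral_Im)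
           (simp add: Re_exp Im_exp)
    qed
    show "char M1 t = char M2 t"
      unfolding rep[OF M1] rep[OF M2]
      using interval_distribution_integral_eq[OF M1 M2 c, of "\<lambda>x. cos (t * x)"]
        interval_distribution_integral_eq[OF M1 M2 c, of "\<lambda>x. sin (t * x)"]
      by (simp add: continuous_intros)
  qed
qed

section \<open>Existence and uniqueness of the equilibrium measure\<close>

locale positive_capacity_set =
  fixes K :: "real set"
  assumes compact_K: "compact K" and K_subset: "K \<subseteq> {-1..1}" and log_cap_pos: "log_cap K > 0"
begin

text \<open>The shift by \<open>ln 2\<close> belongs to \<open>log_kernel\<close>, where it makes the kernel nonnegative on \<open>[-1, 1]\<close>.\<close>
definition v :: real where
  "v = real_of_ereal (robin_const K) + ln 2"

lemma closed_K: "closed K"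
  using compact_K by (rule compact_imp_closed)

lemma interval_distribution_K: "M \<in> prob_measures_on K \<Longrightarrow> interval_distribution M"
  using prob_measures_on_interval closed_K K_subset by blast

lemma robin_const_nonneg: "0 \<le> robin_const K"
  unfolding robin_const_def
proof (rule INF_greatest)
  fix M assume "M \<in> prob_measures_on K"
  then interpret interval_distribution M
    by (rule interval_distribution_K)
  have "enn2ereal (ennreal (ln 2)) \<le> enn2ereal (kernel_energy M)"
    using kernel_energy_ge by (simp add: less_eq_ennreal.rep_eq)
  then have "ereal (ln 2) \<le> enn2ereal (kernel_energy M)"
    by (simp add: enn2ereal_ennreal)
  then show "0 \<le> log_energy M"
    unfolding kernel_energy_log_energy by (cases "enn2ereal (kernel_energy M)") auto
qed

lemma robin_const_eq: "robin_const K = ereal (v - ln 2)"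
proof -
  have "robin_const K \<noteq> \<infinity>"
    using log_cap_pos by (auto simp: log_cap_def)
  then show ?thesis
    using robin_const_nonneg by (cases "robin_const K") (auto simp: v_def)
qed

lemma v_ge: "v \<ge> ln 2"
  using robin_const_nonneg by (simp add: robin_const_eq)

lemma v_pos: "v > 0"
  using v_ge ln_gt_zero[of 2] by linarith

lemma log_cap_eq: "log_cap K = exp (ln 2 - v)"
  by (simp add: log_cap_def robin_const_eq)

lemma log_energy_eq_real:
  assumes "M \<in> prob_measures_on K" "kernel_energy M = ennreal a" "a \<ge> 0"
  shows "log_energy M = ereal (a - ln 2)"
proof -
  interpret interval_distribution M
    using assms(1) by (rule interval_distribution_K)
  show ?thesis
    using assms by (simp add: kernel_energy_log_energy enn2ereal_ennreal)
qed

lemma kernel_energy_ge_v: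
  assumes "M \<in> prob_measures_on K"
  shows "ennreal v \<le> kernel_energy M"
proof (cases "kernel_energy M")
  case (real a)
  have "robin_const K \<le> log_energy M"
    unfolding robin_const_def using assms by (rule INF_lower)
  then show ?thesis
    using real log_energy_eq_real[OF assms real(2,1)] by (simp add: robin_const_eq ennreal_leI)
qed simp

lemma log_energy_eq_robin_iff:
  assumes "M \<in> prob_measures_on K"
  shows "log_energy M = robin_const K \<longleftrightarrow> kernel_energy M = ennreal v"
proof (cases "kernel_energy M")
  case (real a)
  then show ?thesis
    using log_energy_eq_real[OF assms real(2,1)] v_pos by (auto simp: robin_const_eq)
next
  case top
  interpret interval_distribution M
    using assms by (rule interval_distribution_K)
  show ?thesis
    using top by (simp add: kernel_energy_log_energy robin_const_eq)
qed

lemma near_minimiser_exists: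
  assumes "e > 0"
  shows "\<exists>M \<in> prob_measures_on K. kernel_energy M \<le> ennreal (v + e)"
proof -
  have "robin_const K < ereal (v - ln 2 + e)"
    using assms by (simp add: robin_const_eq)
  then obtain M where M: "M \<in> prob_measures_on K" "log_energy M < ereal (v - ln 2 + e)"
    unfolding robin_const_def INF_less_iff by blast
  interpret interval_distribution M
    using M(1) by (rule interval_distribution_K)
  have "kernel_energy M \<le> ennreal (v + e)"
  proof (cases "kernel_energy M")
    case (real a)
    then show ?thesis
      using M(2) log_energy_eq_real[OF M(1) real(2,1)] by (simp add: ennreal_leI)
  next
    case top
    then show ?thesis
      using M(2) by (simp add: kernel_energy_log_energy)
  qed
  then show ?thesis
    using M(1) by blast
qed

text \<open>Weak compactness and lower semicontinuity of the energy. The hypothesis bounds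
  regularised energies so that it also covers discrete measures, whose logarithmic energy is
  infinite; the limit in \<open>j\<close> is taken for each fixed \<open>r\<close>, and only then
  does \<open>r\<close> tend to 1.\<close>

lemma subseq_to_minimiser:
  assumes N: "\<And>j. N j \<in> prob_measures_on K"
    and b: "\<And>r j. 0 < r \<Longrightarrow> r < 1 \<Longrightarrow> 2 * ln 2 + abel_energy r (N j) \<le> b r j"
    and lim: "\<And>r. 0 < r \<Longrightarrow> r < 1 \<Longrightarrow> b r \<longlonglongrightarrow> v - ln r"
  shows "\<exists>s M. strict_mono (s :: nat \<Rightarrow> nat) \<and> M \<in> prob_measures_on K \<and> kernel_energy M = ennreal v \<and>
    (\<forall>f :: real \<Rightarrow> real. \<forall>B. continuous_on UNIV f \<longrightarrow> (\<forall>x. \<bar>f x\<bar> \<le> B) \<longrightarrow>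
       (\<lambda>j. \<integral>x. f x \<partial>N (s j)) \<longlonglongrightarrow> (\<integral>x. f x \<partial>M))"
proof -
  interpret N: interval_distribution "N j" for j
    using N by (rule interval_distribution_K)
  have rdN: "real_distribution (N j)" for j
    by unfold_locales
  have "tight N"
    unfolding tight_def
  proof (intro conjI allI impI)
    show "real_distribution (N n)" for n
      by unfold_locales
    fix e :: real assume "e > 0"
    \<comment> \<open>The half-open interval needs a margin on the left: \<open>{-1<..1}\<close>
      would omit the point \<open>-1\<close>.\<close>
    have "measure (N n) {-2<..2} = 1" for n
    proof -
      have "AE x in N n. x \<in> {-2<..2}"
        by (rule AE_mp[OF N.AE_interval], rule AE_I2) auto
      then show ?thesis
        by (subst N.prob_eq_1) auto
    qed
    then show "\<exists>a b. a < b \<and> (\<forall>n. 1 - e < measure (N n) {a<..b})"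
      using \<open>e > 0\<close> by (intro exI[of _ "-2"] exI[of _ 2]) auto
  qed
  from tight_imp_convergent_subsubsequence[OF this, of id]
  obtain s M where s: "strict_mono (s :: nat \<Rightarrow> nat)" and M: "real_distribution M" and w: "weak_conv_m (N \<circ> s) M"
    by (auto simp: strict_mono_id o_def id_def strict_mono_def)
  interpret M: real_distribution M by fact
  have conv: "(\<lambda>j. \<integral>x. f x \<partial>N (s j)) \<longlonglongrightarrow> (\<integral>x. f x \<partial>M)"
    if "continuous_on UNIV f" "\<And>x. \<bar>f x\<bar> \<le> B" for f :: "real \<Rightarrow> real" and B
  proof -
    have "(\<lambda>j. integral\<^sup>L ((N \<circ> s) j) f) \<longlonglongrightarrow> integral\<^sup>L M f"
      by (rule weak_conv_imp_integral_bdd_continuous_conv[OF _ M w, of f B])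
         (use that rdN in \<open>auto simp: continuous_on_eq_continuous_at\<close>)
    then show ?thesis
      by simp
  qed
  have Kne: "K \<noteq> {}"
  proof
    assume "K = {}"
    then have "emeasure (N 0) UNIV = 0"
      using N[of 0] by (simp add: prob_measures_on_def)
    then show False
      by simp
  qed
  have MK: "AE x in M. x \<in> K"
  proof -
    \<comment> \<open>Bounded, continuous and zero exactly on the closed set \<open>K\<close>:
      testing weak convergence on it shows that the limit lives on \<open>K\<close>.\<close>
    define f where "f x = min 1 (infdist x K)" for x
    have f: "continuous_on UNIV f" "\<And>x. 0 \<le> f x" "\<And>x. \<bar>f x\<bar> \<le> 1"
      unfolding f_def by (auto intro!: continuous_intros simp: infdist_nonneg)
    have "(\<integral>x. f x \<partial>N j) = 0" for j
    proof -
      have "AE x in N j. f x = 0"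
        by (rule AE_mp[OF prob_measures_on_imp(2)[OF N closed_K]], rule AE_I2) (auto simp: f_def)
      then show ?thesis
        by (rule integral_eq_zero_AE)
    qed
    then have "(\<lambda>j. 0) \<longlonglongrightarrow> (\<integral>x. f x \<partial>M)"
      using conv[OF f(1,3)] by simp
    then have "(\<integral>x. f x \<partial>M) = 0"
      using LIMSEQ_unique tendsto_const by blast
    moreover have "integrable M f"
    proof (rule M.integrable_bounded_measurable[OF _ f(3)])
      have "f \<in> borel_measurable borel"
        using f(1) by (rule borel_measurable_continuous_onI)
      then show "f \<in> borel_measurable M"
        by simp
    qed
    ultimately have "AE x in M. f x = 0"
      using f(2) by (subst (asm) integral_nonneg_eq_0_iff_AE) auto
    then show ?thesis
      by (rule AE_mp, intro AE_I2) (auto simp: f_def in_closed_iff_infdist_zero[OF closed_K Kne] min_def split: if_splits)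
  qed
  have MP: "M \<in> prob_measures_on K"
    by (rule prob_measures_onI[OF M MK closed_K])
  interpret M: interval_distribution M
    using MP by (rule interval_distribution_K)
  have cheb: "(\<lambda>j. cheb_coeff k (N (s j))) \<longlonglongrightarrow> cheb_coeff k M" for k
    unfolding cheb_coeff_def
    by (rule conv[of _ 1]) (auto intro!: continuous_intros continuous_on_ang)
  have le: "2 * ln 2 + abel_energy r M \<le> v - ln r" if r: "0 < r" "r < 1" for r
  proof -
    \<comment> \<open>Finitely many coefficients converge and the omitted terms are nonnegative, so
      the bound passes to each partial sum of the limit measure.\<close>
    have "(\<Sum>k<m. 2 * r ^ k / k * (cheb_coeff k M)\<^sup>2) \<le> v - ln r - 2 * ln 2" for m
    proof (rule LIMSEQ_le)
      show "(\<lambda>j. \<Sum>k<m. 2 * r ^ k / k * (cheb_coeff k (N (s j)))\<^sup>2) \<longlonglongrightarrow> (\<Sum>k<m. 2 * r ^ k / k * (cheb_coeff k M)\<^sup>2)"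
        by (intro tendsto_intros cheb)
      show "(\<lambda>j. b r (s j) - 2 * ln 2) \<longlonglongrightarrow> v - ln r - 2 * ln 2"
        using LIMSEQ_subseq_LIMSEQ[OF lim[OF r] s] by (intro tendsto_intros) (auto simp: o_def)
      have "(\<Sum>k<m. 2 * r ^ k / k * (cheb_coeff k (N (s j)))\<^sup>2) \<le> b r (s j) - 2 * ln 2" for j
      proof -
        have "(\<Sum>k<m. 2 * r ^ k / k * (cheb_coeff k (N (s j)))\<^sup>2) \<le> abel_energy r (N (s j))"
          unfolding abel_energy_def using r by (intro sum_le_suminf N.summable_abel_energy) auto
        then show ?thesis
          using b[OF r, of "s j"] by linarith
      qed
      then show "\<exists>n0. \<forall>j\<ge>n0. (\<Sum>k<m. 2 * r ^ k / k * (cheb_coeff k (N (s j)))\<^sup>2) \<le> b r (s j) - 2 * ln 2"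
        by blast
    qed
    then have "abel_energy r M \<le> v - ln r - 2 * ln 2"
      unfolding abel_energy_def using r by (intro suminf_le_const M.summable_abel_energy) auto
    then show ?thesis
      by simp
  qed
  have "kernel_energy M \<le> ennreal v"
  proof (rule M.kernel_energy_le_lim)
    show "2 * ln 2 + abel_energy (rad n) M \<le> v - ln (rad n)" for n
      using le rad_bounds by blast
    have "(\<lambda>n. v - ln (rad n)) \<longlonglongrightarrow> v - ln 1"
      by (intro tendsto_intros rad_tendsto) auto
    then show "(\<lambda>n. v - ln (rad n)) \<longlonglongrightarrow> v"
      by simp
  qed
  then have "kernel_energy M = ennreal v"
    using kernel_energy_ge_v[OF MP] by (rule antisym)
  then show ?thesis
    using s MP conv by blast
qed

lemma minimiser_exists: "\<exists>M \<in> prob_measures_on K. kernel_energy M = ennreal v"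
proof -
  have "\<forall>j :: nat. \<exists>M \<in> prob_measures_on K. kernel_energy M \<le> ennreal (v + 1 / real (Suc j))"
    using near_minimiser_exists by simp
  then obtain N where N: "\<And>j. N j \<in> prob_measures_on K" "\<And>j. kernel_energy (N j) \<le> ennreal (v + 1 / real (Suc j))"
    by metis
  have "2 * ln 2 + abel_energy r (N j) \<le> v + 1 / real (Suc j) - ln r" if r: "0 < r" "r < 1" for r j
  proof -
    interpret interval_distribution "N j"
      using N(1) by (rule interval_distribution_K)
    have "ln r \<le> 0"
      using r by simp
    have "ennreal (2 * ln 2 + abel_energy r (N j)) \<le> kernel_energy (N j) + ennreal (- ln r)"
      using r by (rule abel_energy_le)
    also have "\<dots> \<le> ennreal (v + 1 / real (Suc j)) + ennreal (- ln r)"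
      by (intro add_right_mono N)
    also have "\<dots> = ennreal (v + 1 / real (Suc j) - ln r)"
      using v_pos \<open>ln r \<le> 0\<close> by (subst ennreal_plus[symmetric]) auto
    finally have "ennreal (2 * ln 2 + abel_energy r (N j)) \<le> ennreal (v + 1 / real (Suc j) - ln r)" .
    moreover have "0 \<le> 1 / real (Suc j)"
      by simp
    then have "0 \<le> v + 1 / real (Suc j) - ln r"
      using v_pos \<open>ln r \<le> 0\<close> by linarith
    ultimately show ?thesis
      by (subst (asm) ennreal_le_iff)
  qed
  moreover have "(\<lambda>j. v + 1 / real (Suc j) - ln r) \<longlonglongrightarrow> v - ln r" for r
    by real_asymp
  ultimately show ?thesis
    using subseq_to_minimiser[where N = N, OF N(1), where b = "\<lambda>r j. v + 1 / real (Suc j) - ln r"] by blast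
qed

text \<open>Strict convexity: by the parallelogram identity for Chebyshev coefficients, two
  minimisers that differ in some coefficient would have a midpoint of energy below
  \<open>v\<close>.\<close>

lemma minimiser_unique:
  assumes M1: "M1 \<in> prob_measures_on K" "kernel_energy M1 = ennreal v"
    and M2: "M2 \<in> prob_measures_on K" "kernel_energy M2 = ennreal v"
  shows "M1 = M2"
proof -
  interpret M1: interval_distribution M1
    using M1(1) by (rule interval_distribution_K)
  interpret M2: interval_distribution M2
    using M2(1) by (rule interval_distribution_K)
  define F where "F b = (if b then M1 else M2)" for b
  \<comment> \<open>The midpoint \<open>(M1 + M2) / 2\<close>, realised as a fair-coin mixture so
    that \<open>emeasure_bind\<close> and \<open>integral_bind\<close> apply.\<close>
  define M where "M = measure_pmf (bernoulli_pmf (1 / 2)) \<bind> F"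
  have F: "F \<in> measurable (measure_pmf (bernoulli_pmf (1 / 2))) (subprob_algebra borel)"
    using M1.M_in_subprob M2.M_in_subprob
    by (auto simp: F_def measurable_pmf_measure1 space_subprob_algebra M1.subprob_space_axioms M2.subprob_space_axioms)
  have emM: "emeasure M A = emeasure M1 A * ennreal (1 / 2) + emeasure M2 A * ennreal (1 / 2)"
    if "A \<in> sets borel" for A
    unfolding M_def using that
    by (subst emeasure_bind[OF _ F]) (auto simp: F_def nn_integral_bernoulli_pmf)
  have setsM: "sets M = sets borel"
    unfolding M_def by (rule sets_bind_measurable[OF F]) auto
  have "emeasure M UNIV = ennreal (1 / 2) + ennreal (1 / 2)"
    by (subst emM) (simp_all only: M1.measure_UNIV_1 M2.measure_UNIV_1 mult_1 space_in_borel)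
  also have "\<dots> = 1"
    by (subst ennreal_plus[symmetric]) auto
  finally have MP: "M \<in> prob_measures_on K"
    using M1(1) M2(1) closed_K emM[of "UNIV - K"] setsM
    by (auto simp: prob_measures_on_def)
  interpret M: interval_distribution M
    using MP by (rule interval_distribution_K)
  have cheb: "cheb_coeff k M = (cheb_coeff k M1 + cheb_coeff k M2) / 2" for k
  proof -
    have "(\<integral>x. cos (real k * ang x) \<partial>M)
       = (\<integral>b. (\<integral>x. cos (real k * ang x) \<partial>F b) \<partial>measure_pmf (bernoulli_pmf (1 / 2)))"
      unfolding M_def
      by (rule integral_bind[where B = 1 and B' = 1, OF _ _ F])
         (auto simp: F_def measure_pmf.finite_measure_axioms)
    also have "\<dots> = ((\<integral>x. cos (real k * ang x) \<partial>M1) + (\<integral>x. cos (real k * ang x) \<partial>M2)) / 2"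
      by (simp add: F_def add_divide_distrib)
    finally show ?thesis
      by (simp add: cheb_coeff_def)
  qed
  have "cheb_coeff k M1 = cheb_coeff k M2" for k
  \<comment> \<open>Index 0 carries no weight in the energy, but its coefficient is the total mass
    1.\<close>
  proof (cases "k = 0")
    case True
    then show ?thesis
      by (simp add: cheb_coeff_def)
  next
    case False
    \<comment> \<open>The term of index \<open>k\<close> in the parallelogram identity is
      \<open>2 * (r ^ k * D)\<close>; half of it is the energy saved by the midpoint.\<close>
    define D where "D = (cheb_coeff k M1 - cheb_coeff k M2)\<^sup>2 / (2 * real k)"
    have bound: "2 * ln 2 + abel_energy r M \<le> v - ln r - r ^ k * D" if r: "0 < r" "r < 1" for r
    proof -
      have le: "2 * ln 2 + abel_energy r N \<le> v - ln r"
        if "interval_distribution N" "kernel_energy N = ennreal v" for N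
      proof -
        interpret interval_distribution N by fact
        have "ennreal (2 * ln 2 + abel_energy r N) \<le> ennreal v + ennreal (- ln r)"
          using abel_energy_le[OF r] that by simp
        also have "\<dots> = ennreal (v - ln r)"
          using v_pos r by (subst ennreal_plus[symmetric]) auto
        finally have "ennreal (2 * ln 2 + abel_energy r N) \<le> ennreal (v - ln r)" .
        moreover have "0 \<le> v - ln r"
          using v_pos r ln_le_zero_iff[of r] by linarith
        ultimately show ?thesis
          by (subst (asm) ennreal_le_iff)
      qed
      let ?a = "\<lambda>i. 2 * r ^ i / real i"
      let ?d = "\<lambda>i. (cheb_coeff i M1)\<^sup>2 + (cheb_coeff i M2)\<^sup>2 - 2 * (cheb_coeff i M)\<^sup>2"
      have d: "?d i = (cheb_coeff i M1 - cheb_coeff i M2)\<^sup>2 / 2" for i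
        by (simp add: cheb power2_eq_square field_simps)
      have sums: "(\<lambda>i. ?a i * ?d i) sums (abel_energy r M1 + abel_energy r M2 - 2 * abel_energy r M)"
      proof -
        have "(\<lambda>i. ?a i * (cheb_coeff i M1)\<^sup>2 + ?a i * (cheb_coeff i M2)\<^sup>2 - 2 * (?a i * (cheb_coeff i M)\<^sup>2))
          sums (abel_energy r M1 + abel_energy r M2 - 2 * abel_energy r M)"
          unfolding abel_energy_def using r
          by (intro sums_diff sums_add sums_mult summable_sums M.summable_abel_energy
              M1.summable_abel_energy M2.summable_abel_energy) auto
        then show ?thesis
          by (simp only: distrib_left right_diff_distrib mult.left_commute[of 2])
      qed
      have "(\<Sum>i\<in>{k}. ?a i * ?d i) \<le> (\<Sum>i. ?a i * ?d i)"
        using r by (intro sum_le_suminf sums_summable[OF sums]) (auto simp: d)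
      then have "?a k * ?d k \<le> abel_energy r M1 + abel_energy r M2 - 2 * abel_energy r M"
        using sums_unique[OF sums] by simp
      moreover have "?a k * ?d k = 2 * (r ^ k * D)"
        unfolding d by (simp add: D_def)
      moreover have "2 * ln 2 + abel_energy r M1 \<le> v - ln r" "2 * ln 2 + abel_energy r M2 \<le> v - ln r"
        by (intro le M1.interval_distribution_axioms M2.interval_distribution_axioms M1 M2)+
      ultimately show ?thesis
        by linarith
    qed
    have "kernel_energy M \<le> ennreal (v - D)"
    proof (rule M.kernel_energy_le_lim)
      show "2 * ln 2 + abel_energy (rad n) M \<le> v - ln (rad n) - rad n ^ k * D" for n
        using bound rad_bounds by blast
      have "(\<lambda>n. v - ln (rad n) - rad n ^ k * D) \<longlonglongrightarrow> v - ln 1 - 1 ^ k * D"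
        by (intro tendsto_intros rad_tendsto) auto
      then show "(\<lambda>n. v - ln (rad n) - rad n ^ k * D) \<longlonglongrightarrow> v - D"
        by simp
    qed
    then have "ennreal v \<le> ennreal (v - D)"
      using kernel_energy_ge_v[OF MP] by (rule order_trans[rotated])
    then have "D \<le> 0"
      using v_pos by (cases "v - D \<ge> 0") (auto simp: ennreal_neg)
    then have "(cheb_coeff k M1 - cheb_coeff k M2)\<^sup>2 \<le> 0"
      using False by (simp add: D_def divide_le_0_iff)
    then show ?thesis
      by simp
  qed
  then show ?thesis
    by (intro interval_distribution_eqI M1.interval_distribution_axioms M2.interval_distribution_axioms)
qed

abbreviation \<mu> :: "real measure" where
  "\<mu> \<equiv> equilibrium_measure K"

lemma equilibrium_unique:
  assumes "M \<in> prob_measures_on K" "kernel_energy M = ennreal v"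
  shows "M = \<mu>"
proof -
  have "\<mu> = M"
    unfolding equilibrium_measure_def
  proof (rule the_equality)
    show "M \<in> prob_measures_on K \<and> log_energy M = robin_const K"
      using assms log_energy_eq_robin_iff by blast
  next
    fix N assume "N \<in> prob_measures_on K \<and> log_energy N = robin_const K"
    then show "N = M"
      using assms log_energy_eq_robin_iff minimiser_unique by blast
  qed
  then show ?thesis ..
qed

lemma equilibrium: "\<mu> \<in> prob_measures_on K" "kernel_energy \<mu> = ennreal v"
  using minimiser_exists equilibrium_unique by blast+

end

section \<open>The potential of the equilibrium measure of a regular set\<close>

lemma ln_strictly_concave:
  fixes p q l :: real
  assumes "p > 0" "q > 0" "p \<noteq> q" "0 < l" "l < 1"
  shows "l * ln p + (1 - l) * ln q < ln (l * p + (1 - l) * q)"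
proof -
  define m where "m = l * p + (1 - l) * q"
  have m: "m > 0"
    unfolding m_def using assms by (intro add_pos_pos) auto
  have *: "ln z < z - 1" if "z > 0" "z \<noteq> 1" for z :: real
    using that ln_le_minus_one[of z] ln_eq_minus_one[of z] by force
  have "m - p = (1 - l) * (q - p)" "m - q = l * (p - q)"
    by (simp_all add: m_def algebra_simps)
  then have "p \<noteq> m" "q \<noteq> m"
    using assms by auto
  then have "ln (p / m) < p / m - 1" "ln (q / m) < q / m - 1"
    using assms m by (intro *; simp)+
  then have "l * ln (p / m) + (1 - l) * ln (q / m) < l * (p / m - 1) + (1 - l) * (q / m - 1)"
    using assms by (intro add_strict_mono mult_strict_left_mono) auto
  also have "\<dots> = (l * p + (1 - l) * q) / m - 1"
    by (simp add: algebra_simps add_divide_distrib diff_divide_distrib)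
  also have "\<dots> = 0"
    using m by (simp add: m_def[symmetric])
  finally have "l * (ln p - ln m) + (1 - l) * (ln q - ln m) < 0"
    using assms m by (simp add: ln_divide_pos)
  then have "l * ln p + (1 - l) * ln q < ln m"
    by (simp add: algebra_simps)
  then show ?thesis
    unfolding m_def .
qed

text \<open>With values in the extended nonnegative reals the kernel is even continuous in its first
  argument: near \<open>x = t\<close> it is either infinite or large.\<close>

lemma log_kernel_lsc:
  assumes "y \<longlonglongrightarrow> x"
  shows "log_kernel x t \<le> liminf (\<lambda>n. log_kernel (y n) t)"
proof -
  have "(\<lambda>n. log_kernel (y n) t) \<longlonglongrightarrow> log_kernel x t"
  proof (cases "x = t")
    case False
    have "(\<lambda>n. ennreal (ln 2 - ln \<bar>y n - t\<bar>)) \<longlonglongrightarrow> ennreal (ln 2 - ln \<bar>x - t\<bar>)"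
      using False by (intro tendsto_ennrealI tendsto_intros assms) auto
    moreover have "\<forall>\<^sub>F n in sequentially. y n \<noteq> t"
      using assms False by (rule tendsto_imp_eventually_ne)
    then have "\<forall>\<^sub>F n in sequentially. ennreal (ln 2 - ln \<bar>y n - t\<bar>) = log_kernel (y n) t"
      by eventually_elim (simp add: log_kernel_def)
    ultimately show ?thesis
      using False by (simp add: log_kernel_def tendsto_cong)
  next
    case True
    show ?thesis
    proof (rule order_tendstoI)
      fix a assume "a < log_kernel x t"
      then obtain c where c: "a = ennreal c" "c \<ge> 0"
        using True by (cases a) (auto simp: log_kernel_def)
      have "\<forall>\<^sub>F n in sequentially. dist (y n) x < exp (ln 2 - c - 1)"
        using assms by (rule tendstoD) simp
      then show "\<forall>\<^sub>F n in sequentially. a < log_kernel (y n) t"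
      proof eventually_elim
        case (elim n)
        show ?case
        proof (cases "y n = t")
          case False
          then have "ln \<bar>y n - t\<bar> < ln (exp (ln 2 - c - 1))"
            using elim True by (subst ln_less_cancel_iff) (auto simp: dist_real_def)
          then have "c < ln 2 - ln \<bar>y n - t\<bar>"
            by simp
          then show ?thesis
            using False c by (simp add: log_kernel_def ennreal_less_iff)
        qed (use c in \<open>simp add: log_kernel_def\<close>)
      qed
    qed (use True in \<open>simp add: log_kernel_def\<close>)
  qed
  then show ?thesis
    using lim_imp_Liminf[of sequentially] by fastforce
qed

lemma closed_measure_support: "sets M = sets borel \<Longrightarrow> closed (measure_support M)"
  unfolding closed_def open_contains_ball
proof
  fix x assume s: "sets M = sets borel" and "x \<in> - measure_support M"
  then obtain e where e: "e > 0" "emeasure M (ball x e) = 0"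
    by (auto simp: measure_support_def)
  have "y \<in> - measure_support M" if y: "y \<in> ball x e" for y
  proof -
    obtain d where d: "d > 0" "ball y d \<subseteq> ball x e"
      using y open_contains_ball open_ball by blast
    then have "emeasure M (ball y d) \<le> emeasure M (ball x e)"
      using s by (intro emeasure_mono) auto
    then show ?thesis
      using d e by (auto simp: measure_support_def)
  qed
  then show "\<exists>e>0. ball x e \<subseteq> - measure_support M"
    using e by blast
qed

text \<open>The complement of the support is a union of null balls, and by Lindelof countably many
  of them suffice.\<close>

lemma AE_measure_support:
  assumes s: "sets M = sets borel"
  shows "AE x in M. x \<in> measure_support M"
proof -
  define F where "F = {ball x e | x e. e > 0 \<and> emeasure M (ball x e) = 0}"
  have "\<And>S. S \<in> F \<Longrightarrow> open S"
    by (auto simp: F_def)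
  then obtain F' where F': "F' \<subseteq> F" "countable F'" "\<Union>F' = \<Union>F"
    using Lindelof by metis
  have "(\<Union>S\<in>F'. S) \<in> null_sets M"
  proof (rule null_sets_UN')
    show "countable F'" by fact
    show "S \<in> null_sets M" if "S \<in> F'" for S
      using that F'(1) s by (auto simp: F_def null_sets_def)
  qed
  moreover have "x \<in> (\<Union>S\<in>F'. S)" if nx: "x \<notin> measure_support M" for x
  proof -
    obtain e where "e > 0" "emeasure M (ball x e) = 0"
      using nx by (auto simp: measure_support_def)
    then have "x \<in> \<Union>F"
      unfolding F_def using centre_in_ball[of x e] by blast
    then show ?thesis
      using F'(3) by auto
  qed
  ultimately show ?thesis
    by (intro AE_I'[of "\<Union>S\<in>F'. S"]) auto
qed

locale regular_interval_set = positive_capacity_set +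
  assumes green_tendsto: "\<And>x. x \<in> K \<Longrightarrow>
    (green_fun K \<longlongrightarrow> 0) (at (complex_of_real x) within - (complex_of_real ` K))"
begin

sublocale eq: interval_distribution \<mu>
  using equilibrium(1) by (rule interval_distribution_K)

lemma AE_K: "AE x in \<mu>. x \<in> K"
  using equilibrium(1) closed_K by (rule prob_measures_on_imp)

lemma ln_log_cap: "ln (log_cap K) = ln 2 - v"
  by (simp add: log_cap_eq)

text \<open>The logarithmic potential of the equilibrium measure, shifted by \<open>ln 2\<close>; it
  will turn out to equal \<open>v\<close> everywhere on \<open>K\<close>.\<close>

definition pot :: "real \<Rightarrow> ennreal" where
  "pot x = (\<integral>\<^sup>+t. log_kernel x t \<partial>\<mu>)"

lemma measurable_log_kernel_eq [measurable]: "log_kernel x \<in> borel_measurable \<mu>"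
  unfolding eq.borel_measurable_eq by measurable

lemma pot_measurable: "pot \<in> borel_measurable \<mu>"
  unfolding pot_def using log_kernel_measurable
  by (intro eq.borel_measurable_nn_integral) (simp only: eq.borel_measurable_pair_eq)

text \<open>The point \<open>x\<close> is approached vertically. The distance from
  \<open>y n\<close> to a real \<open>t\<close> is at least \<open>|x - t|\<close>, so
  \<open>v - green_fun K (y n)\<close> is at most \<open>pot x\<close>, and regularity sends the
  Green function to 0.\<close>

lemma pot_ge_v:
  assumes x: "x \<in> K"
  shows "ennreal v \<le> pot x"
proof -
  define y where "y n = Complex x (1 / real (Suc n))" for n
  have Im_y: "Im (y n) \<noteq> 0" for n
    by (simp add: y_def)
  have "filterlim y (at (complex_of_real x) within - (complex_of_real ` K)) sequentially"
    unfolding filterlim_at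
  proof
    show "\<forall>\<^sub>F n in sequentially. y n \<in> - complex_of_real ` K \<and> y n \<noteq> complex_of_real x"
      using Im_y by (intro always_eventually allI) (auto simp: complex_eq_iff)
    have "(\<lambda>n. 1 / real (Suc n)) \<longlonglongrightarrow> 0"
      by real_asymp
    then have "y \<longlonglongrightarrow> Complex x 0"
      unfolding y_def by (intro tendsto_Complex tendsto_const)
    then show "y \<longlonglongrightarrow> complex_of_real x"
      by (simp add: complex_of_real_def)
  qed
  then have lim: "(\<lambda>n. green_fun K (y n)) \<longlonglongrightarrow> 0"
    by (rule filterlim_compose[OF green_tendsto[OF x]])
  have "ennreal (v - green_fun K (y n)) \<le> pot x" for n
  proof -
    define d where "d t = cmod (y n - complex_of_real t)" for t
    define g where "g t = ln 2 - ln (d t)" for t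
    have x1: "\<bar>x\<bar> \<le> 1"
      using subsetD[OF K_subset x] by (simp add: abs_le_iff)
    have d_ge: "d t \<ge> \<bar>x - t\<bar>" "d t \<ge> 1 / real (Suc n)" for t
      unfolding d_def using abs_Re_le_cmod[of "y n - complex_of_real t"] abs_Im_le_cmod[of "y n - complex_of_real t"]
      by (auto simp: y_def)
    have d_pos: "d t > 0" for t
      using d_ge(2)[of t] by (smt (verit) of_nat_0_less_iff zero_less_Suc zero_less_divide_1_iff)
    have d_le: "d t \<le> 3" if "t \<in> {-1..1}" for t
    proof -
      have "d t \<le> \<bar>x - t\<bar> + \<bar>1 / real (Suc n)\<bar>"
        unfolding d_def using cmod_le[of "y n - complex_of_real t"] by (simp add: y_def)
      moreover have "\<bar>1 / real (Suc n)\<bar> \<le> 1"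
        by simp
      ultimately show ?thesis
        using x1 that unfolding atLeastAtMost_iff by linarith
    qed
    have [measurable]: "d \<in> borel_measurable borel"
      unfolding d_def by measurable
    have gb: "\<bar>g t\<bar> \<le> ln 2 + ln 3 + ln (real (Suc n))" if "t \<in> {-1..1}" for t
    proof -
      have "ln (d t) \<le> ln 3"
        using d_le[OF that] d_pos by (intro ln_mono) auto
      moreover have "ln (1 / real (Suc n)) \<le> ln (d t)"
        using d_ge(2) d_pos by (intro ln_mono) auto
      then have "- ln (real (Suc n)) \<le> ln (d t)"
        by (simp add: ln_div)
      moreover have "ln (real (Suc n)) \<ge> 0" "ln (3::real) \<ge> 0" "ln (2::real) \<ge> 0"
        by simp_all
      ultimately show ?thesis
        unfolding g_def by linarith
    qed
    have AEb: "AE t in \<mu>. norm (g t) \<le> ln 2 + ln 3 + ln (real (Suc n))"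
      using eq.AE_interval by eventually_elim (use gb in \<open>simp only: real_norm_def\<close>)
    have int: "integrable \<mu> g"
      by (rule eq.integrable_const_bound[OF AEb]) (simp add: g_def[abs_def] eq.borel_measurable_eq)
    have intln: "integrable \<mu> (\<lambda>t. ln (d t))"
      using Bochner_Integration.integrable_diff[OF _ int, of "\<lambda>_. ln 2"] by (simp add: g_def)
    have "v - green_fun K (y n) = (\<integral>t. g t \<partial>\<mu>)"
      using intln by (simp add: green_fun_def ln_log_cap d_def[symmetric] g_def)
    \<comment> \<open>Since \<open>d t\<close> may exceed 2, \<open>g t\<close> may be negative,
      whereas \<open>log_kernel\<close> is nonnegative.\<close>
    also have "\<dots> \<le> (\<integral>t. max 0 (g t) \<partial>\<mu>)"
      using int by (intro integral_mono integrable_max) auto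
    finally have "ennreal (v - green_fun K (y n)) \<le> ennreal (\<integral>t. max 0 (g t) \<partial>\<mu>)"
      by (rule ennreal_leI)
    also have "\<dots> = (\<integral>\<^sup>+t. ennreal (max 0 (g t)) \<partial>\<mu>)"
      using int by (intro nn_integral_eq_integral[symmetric] integrable_max) auto
    also have "\<dots> \<le> pot x"
      unfolding pot_def
    proof (rule nn_integral_mono_AE)
      show "AE t in \<mu>. ennreal (max 0 (g t)) \<le> log_kernel x t"
        using eq.AE_interval
      proof eventually_elim
        case (elim t)
        show ?case
        proof (cases "x = t")
          case False
          then have "g t \<le> ln 2 - ln \<bar>x - t\<bar>"
            using d_ge(1)[of t] unfolding g_def by (intro diff_left_mono ln_mono) auto
          moreover have "0 \<le> ln 2 - ln \<bar>x - t\<bar>"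
            using ln_abs_diff_le_ln2[of x t] x K_subset elim by auto
          ultimately show ?thesis
            using False by (simp add: log_kernel_def ennreal_leI)
        qed (simp add: log_kernel_def)
      qed
    qed
    finally show ?thesis .
  qed
  moreover have "(\<lambda>n. ennreal (v - green_fun K (y n))) \<longlonglongrightarrow> ennreal (v - 0)"
    by (intro tendsto_ennrealI tendsto_intros lim)
  ultimately show ?thesis
    using LIMSEQ_le_const2[of "\<lambda>n. ennreal (v - green_fun K (y n))" "ennreal v" "pot x"] by auto
qed

text \<open>The mean of \<open>pot\<close> is the energy \<open>v\<close>, and \<open>pot\<close> is
  at least \<open>v\<close> on \<open>K\<close>, so the excess has integral 0.\<close>

lemma AE_pot_le_v: "AE x in \<mu>. pot x \<le> ennreal v"
proof -
  have ge: "AE x in \<mu>. ennreal v \<le> pot x"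
    using AE_K by eventually_elim (rule pot_ge_v)
  have "(\<integral>\<^sup>+x. pot x - ennreal v \<partial>\<mu>) = (\<integral>\<^sup>+x. pot x \<partial>\<mu>) - (\<integral>\<^sup>+x. ennreal v \<partial>\<mu>)"
    using ge pot_measurable by (intro nn_integral_diff) auto
  also have "(\<integral>\<^sup>+x. pot x \<partial>\<mu>) = ennreal v"
    using equilibrium(2) by (simp add: pot_def kernel_energy_def)
  finally have "(\<integral>\<^sup>+x. pot x - ennreal v \<partial>\<mu>) = 0"
    by simp
  then have "AE x in \<mu>. pot x - ennreal v = 0"
    using pot_measurable by (subst (asm) nn_integral_0_iff_AE) auto
  then show ?thesis
    by eventually_elim (simp add: diff_eq_0_iff_ennreal)
qed

text \<open>Every ball around a support point has positive measure and so contains a point where the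
  bound holds; lower semicontinuity carries it to the centre.\<close>

lemma pot_le_v_support:
  assumes x: "x \<in> measure_support \<mu>"
  shows "pot x \<le> ennreal v"
proof -
  have "\<exists>y. y \<in> ball x (1 / real (Suc n)) \<and> pot y \<le> ennreal v" for n
  proof (rule ccontr)
    assume "\<not> ?thesis"
    then have "AE y in \<mu>. y \<notin> ball x (1 / real (Suc n))"
      using AE_pot_le_v by auto
    then have "emeasure \<mu> (ball x (1 / real (Suc n))) = 0"
      by (subst (asm) AE_iff_measurable[of "ball x (1 / real (Suc n))"]) auto
    then show False
      using x by (auto simp: measure_support_def)
  qed
  then obtain y where y: "\<And>n. y n \<in> ball x (1 / real (Suc n))" "\<And>n. pot (y n) \<le> ennreal v"
    by metis
  have "y \<longlonglongrightarrow> x"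
  proof (rule metric_LIMSEQ_I)
    fix r :: real assume "r > 0"
    then obtain m where m: "1 / real (Suc m) < r"
      using nat_approx_posE by blast
    have "dist (y n) x < r" if "n \<ge> m" for n
    proof -
      have "dist (y n) x < 1 / real (Suc n)"
        using y(1)[of n] by (simp add: dist_commute)
      also have "\<dots> \<le> 1 / real (Suc m)"
        using that by (intro divide_left_mono) auto
      finally show ?thesis
        using m by simp
    qed
    then show "\<exists>no. \<forall>n\<ge>no. dist (y n) x < r"
      by blast
  qed
  then have "pot x \<le> (\<integral>\<^sup>+t. liminf (\<lambda>n. log_kernel (y n) t) \<partial>\<mu>)"
    unfolding pot_def by (intro nn_integral_mono log_kernel_lsc)
  also have "\<dots> \<le> liminf (\<lambda>n. pot (y n))"
    unfolding pot_def by (rule nn_integral_liminf) measurable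
  also have "\<dots> \<le> liminf (\<lambda>n. ennreal v)"
    using y(2) by (intro Liminf_mono always_eventually allI)
  also have "\<dots> = ennreal v"
    by (simp add: Liminf_const)
  finally show ?thesis .
qed

text \<open>A finite potential excludes an atom at \<open>x\<close>; the infinite diagonal value is
  then negligible and \<open>pot x\<close> becomes a Bochner integral.\<close>

lemma pot_finite:
  assumes x: "x \<in> {-1..1}" and fin: "pot x \<le> ennreal c"
  shows "AE t in \<mu>. t \<noteq> x" "integrable \<mu> (\<lambda>t. ln \<bar>x - t\<bar>)"
    "pot x = ennreal (ln 2 - (\<integral>t. ln \<bar>x - t\<bar> \<partial>\<mu>))" "0 \<le> ln 2 - (\<integral>t. ln \<bar>x - t\<bar> \<partial>\<mu>)"
proof -
  have fin': "pot x \<noteq> \<infinity>"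
    using fin by (auto simp: top_unique)
  then have "AE t in \<mu>. log_kernel x t \<noteq> \<infinity>"
    unfolding pot_def by (intro nn_integral_PInf_AE) auto
  then show ne: "AE t in \<mu>. t \<noteq> x"
    by eventually_elim (auto simp: log_kernel_def)
  have [measurable]: "(\<lambda>t. ln 2 - ln \<bar>x - t\<bar>) \<in> borel_measurable \<mu>"
    unfolding eq.borel_measurable_eq by measurable
  have nn: "AE t in \<mu>. 0 \<le> ln 2 - ln \<bar>x - t\<bar>"
    using eq.AE_interval by eventually_elim (use ln_abs_diff_le_ln2[OF x] in auto)
  have eq: "pot x = (\<integral>\<^sup>+t. ennreal (ln 2 - ln \<bar>x - t\<bar>) \<partial>\<mu>)"
    unfolding pot_def
  proof (rule nn_integral_cong_AE)
    show "AE t in \<mu>. log_kernel x t = ennreal (ln 2 - ln \<bar>x - t\<bar>)"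
      using ne by eventually_elim (auto simp: log_kernel_def)
  qed
  have int: "integrable \<mu> (\<lambda>t. ln 2 - ln \<bar>x - t\<bar>)"
    using fin' nn eq by (intro integrableI_nonneg) (auto simp: less_top)
  then show intl: "integrable \<mu> (\<lambda>t. ln \<bar>x - t\<bar>)"
    using Bochner_Integration.integrable_diff[OF _ int, of "\<lambda>_. ln 2"] by simp
  have I: "(\<integral>t. ln 2 - ln \<bar>x - t\<bar> \<partial>\<mu>) = ln 2 - (\<integral>t. ln \<bar>x - t\<bar> \<partial>\<mu>)"
    using intl by simp
  show "pot x = ennreal (ln 2 - (\<integral>t. ln \<bar>x - t\<bar> \<partial>\<mu>))"
    unfolding eq using nn_integral_eq_integral[OF int nn] I by simp
  show "0 \<le> ln 2 - (\<integral>t. ln \<bar>x - t\<bar> \<partial>\<mu>)"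
    using integral_nonneg_AE[OF nn] I by simp
qed

lemma support_subset_K: "measure_support \<mu> \<subseteq> K"
proof
  fix x assume x: "x \<in> measure_support \<mu>"
  show "x \<in> K"
  proof (rule ccontr)
    assume "x \<notin> K"
    then obtain e where e: "e > 0" "ball x e \<subseteq> - K"
      using closed_K open_contains_ball[of "- K"] by (auto simp: closed_def)
    have "emeasure \<mu> (ball x e) \<le> emeasure \<mu> (UNIV - K)"
      using e closed_K by (intro emeasure_mono) auto
    also have "\<dots> = 0"
      using equilibrium(1) by (simp add: prob_measures_on_def)
    finally show False
      using x e by (auto simp: measure_support_def)
  qed
qed

text \<open>Integrating the strict inequality puts \<open>pot x\<close> below a convex combination
  of \<open>pot a\<close> and \<open>pot b\<close>, hence below \<open>v\<close>, against
  \<open>pot_ge_v\<close>.\<close>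

lemma no_strictly_dominated_point:
  assumes x: "x \<in> K" and ab: "a \<in> measure_support \<mu>" "b \<in> measure_support \<mu>" and l: "0 \<le> l" "l \<le> 1"
    and less: "AE t in \<mu>. l * ln \<bar>a - t\<bar> + (1 - l) * ln \<bar>b - t\<bar> < ln \<bar>x - t\<bar>"
    and ne: "AE t in \<mu>. t \<noteq> x"
  shows False
proof -
  have I: "a \<in> {-1..1}" "b \<in> {-1..1}" "x \<in> {-1..1}"
    using ab x support_subset_K K_subset by auto
  note A = pot_finite[OF I(1) pot_le_v_support[OF ab(1)]]
  note B = pot_finite[OF I(2) pot_le_v_support[OF ab(2)]]
  let ?A = "\<integral>t. ln \<bar>a - t\<bar> \<partial>\<mu>" and ?B = "\<integral>t. ln \<bar>b - t\<bar> \<partial>\<mu>"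
  have Av: "ln 2 - ?A \<le> v" "ln 2 - ?B \<le> v"
    using pot_le_v_support[OF ab(1)] pot_le_v_support[OF ab(2)] A(3) B(3) v_pos by auto
  let ?f = "\<lambda>t. l * ln \<bar>a - t\<bar> + (1 - l) * ln \<bar>b - t\<bar>"
  have intf: "integrable \<mu> ?f"
    using A(2) B(2) by simp
  have If: "ln 2 - (\<integral>t. ?f t \<partial>\<mu>) \<le> v"
  proof -
    have "(\<integral>t. ?f t \<partial>\<mu>) = l * ?A + (1 - l) * ?B"
      using A(2) B(2) by simp
    also have "\<dots> \<ge> l * (ln 2 - v) + (1 - l) * (ln 2 - v)"
      using Av l by (intro add_mono mult_left_mono) auto
    finally show ?thesis
      by (simp add: algebra_simps)
  qed
  have nnf: "AE t in \<mu>. 0 \<le> ln 2 - ?f t"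
    using eq.AE_interval
  proof eventually_elim
    case (elim t)
    have "l * ln \<bar>a - t\<bar> \<le> l * ln 2" "(1 - l) * ln \<bar>b - t\<bar> \<le> (1 - l) * ln 2"
      using l ln_abs_diff_le_ln2[OF I(1) elim] ln_abs_diff_le_ln2[OF I(2) elim]
      by (intro mult_left_mono; simp)+
    then show ?case
      by (simp add: algebra_simps)
  qed
  have "pot x \<le> (\<integral>\<^sup>+t. ennreal (ln 2 - ?f t) \<partial>\<mu>)"
    unfolding pot_def
  proof (rule nn_integral_mono_AE)
    show "AE t in \<mu>. log_kernel x t \<le> ennreal (ln 2 - ?f t)"
      using less ne by eventually_elim (auto simp: log_kernel_def intro!: ennreal_leI)
  qed
  also have "\<dots> = ennreal (\<integral>t. ln 2 - ?f t \<partial>\<mu>)"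
    using intf nnf by (intro nn_integral_eq_integral) auto
  finally have fin: "pot x \<le> ennreal (\<integral>t. ln 2 - ?f t \<partial>\<mu>)" .
  note X = pot_finite[OF I(3) fin]
  have "(\<integral>t. ?f t \<partial>\<mu>) < (\<integral>t. ln \<bar>x - t\<bar> \<partial>\<mu>)"
    using intf X(2) less by (intro eq.integral_less_AE_space) auto
  then have "ln 2 - (\<integral>t. ln \<bar>x - t\<bar> \<partial>\<mu>) < v"
    using If by linarith
  then have "pot x < ennreal v"
    using X(3,4) by (simp add: ennreal_lessI v_pos)
  then show False
    using pot_ge_v[OF x] by simp
qed

text \<open>A point of \<open>K\<close> off the support would be strictly dominated: by the nearest
  support point if the support lies on one side of it, otherwise, by concavity of \<open>ln\<close>,
  by the two ends of the gap around it.\<close>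

lemma support_eq_K: "measure_support \<mu> = K"
proof
  show "measure_support \<mu> \<subseteq> K"
    by (rule support_subset_K)
  show "K \<subseteq> measure_support \<mu>"
  proof
    fix x assume x: "x \<in> K"
    let ?S = "measure_support \<mu>"
    have clS: "closed ?S"
      by (rule closed_measure_support) simp
    have cS: "compact ?S"
      using compact_Int_closed[OF compact_K clS] support_subset_K by (simp add: inf_absorb2)
    have AES: "AE t in \<mu>. t \<in> ?S"
      by (rule AE_measure_support) simp
    have Sne: "?S \<noteq> {}"
    proof
      assume "?S = {}"
      then have "AE t in \<mu>. False"
        using AES by simp
      then show False
        by simp
    qed
    show "x \<in> ?S"
    proof (rule ccontr)
      assume nx: "x \<notin> ?S"
      have ne: "AE t in \<mu>. t \<noteq> x"
        using AES by eventually_elim (use nx in auto)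
      have nes: "AE t in \<mu>. t \<noteq> s" if "s \<in> ?S" for s
        using pot_finite(1)[of s v] pot_le_v_support[OF that] that support_subset_K K_subset by blast
      let ?A = "?S \<inter> {..x}" and ?B = "?S \<inter> {x..}"
      have cAB: "compact ?A" "compact ?B"
        using cS by (auto intro: compact_Int_closed)
      consider "?A = {}" | "?B = {}" | "?A \<noteq> {}" "?B \<noteq> {}"
        by blast
      then show False
      proof cases
        case 1
        then have "?S \<subseteq> {x<..}"
          using nx by (auto simp: not_le)
        moreover obtain b where b: "b \<in> ?S" "\<And>t. t \<in> ?S \<Longrightarrow> b \<le> t"
          using compact_attains_inf[OF cS Sne] by blast
        \<comment> \<open>The support lies to the right of \<open>x\<close>, so its leftmost point
          \<open>b\<close> is closer than \<open>x\<close> to every \<open>t\<close> in it.\<close>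
        have "AE t in \<mu>. 1 * ln \<bar>b - t\<bar> + (1 - 1) * ln \<bar>b - t\<bar> < ln \<bar>x - t\<bar>"
          using AES nes[OF b(1)]
        proof eventually_elim
          case (elim t)
          then show ?case
            using b(2)[of t] calculation b(1) by auto
        qed
        then show False
          using no_strictly_dominated_point[OF x b(1) b(1) _ _ _ ne, of 1] by simp
      next
        case 2
        then have "?S \<subseteq> {..<x}"
          using nx by (auto simp: not_le)
        moreover obtain a where a: "a \<in> ?S" "\<And>t. t \<in> ?S \<Longrightarrow> t \<le> a"
          using compact_attains_sup[OF cS Sne] by blast
        have "AE t in \<mu>. 1 * ln \<bar>a - t\<bar> + (1 - 1) * ln \<bar>a - t\<bar> < ln \<bar>x - t\<bar>"
          using AES nes[OF a(1)]
        proof eventually_elim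
          case (elim t)
          then show ?case
            using a(2)[of t] calculation a(1) by auto
        qed
        then show False
          using no_strictly_dominated_point[OF x a(1) a(1) _ _ _ ne, of 1] by simp
      next
        case 3
        obtain a where a: "a \<in> ?A" "\<And>t. t \<in> ?A \<Longrightarrow> t \<le> a"
          using compact_attains_sup[OF cAB(1)] 3 by blast
        obtain b where b: "b \<in> ?B" "\<And>t. t \<in> ?B \<Longrightarrow> b \<le> t"
          using compact_attains_inf[OF cAB(2)] 3 by blast
        have ab: "a < x" "x < b" "a \<in> ?S" "b \<in> ?S"
          using a(1) b(1) nx by (auto simp: less_le)
        \<comment> \<open>The barycentric weight of \<open>x\<close> between the gap ends
          \<open>a\<close> and \<open>b\<close>. No support point lies strictly between these, so
          \<open>a - t\<close>, \<open>b - t\<close> and \<open>x - t\<close> have the same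
          sign.\<close>
        define l where "l = (b - x) / (b - a)"
        have l: "0 < l" "l < 1"
          using ab by (auto simp: l_def)
        have xl: "x = l * a + (1 - l) * b"
        proof -
          have "l * (b - a) = b - x"
            using ab by (simp add: l_def)
          then show ?thesis
            by (simp add: algebra_simps)
        qed
        have "AE t in \<mu>. l * ln \<bar>a - t\<bar> + (1 - l) * ln \<bar>b - t\<bar> < ln \<bar>x - t\<bar>"
          using AES nes[OF ab(3)] nes[OF ab(4)]
        proof eventually_elim
          case (elim t)
          consider "t < a" | "t > b"
            using elim a(2)[of t] b(2)[of t] nx by (cases t x rule: linorder_cases) force+
          then show ?case
          proof cases
            case 1
            then have "l * ln (a - t) + (1 - l) * ln (b - t) < ln (l * (a - t) + (1 - l) * (b - t))"
              using ab l by (intro ln_strictly_concave) auto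
            also have "l * (a - t) + (1 - l) * (b - t) = x - t"
              by (subst xl) (simp add: algebra_simps)
            finally show ?thesis
              using 1 ab by simp
          next
            case 2
            then have "l * ln (t - a) + (1 - l) * ln (t - b) < ln (l * (t - a) + (1 - l) * (t - b))"
              using ab l by (intro ln_strictly_concave) auto
            also have "l * (t - a) + (1 - l) * (t - b) = t - x"
              by (subst xl) (simp add: algebra_simps)
            finally show ?thesis
              using 2 ab by simp
          qed
        qed
        then show False
          using no_strictly_dominated_point[OF x ab(3,4) _ _ _ ne, of l] l by simp
      qed
    qed
  qed
qed

text \<open>Frostman's equality with no exceptional set: the lower bound for the potential comes
  from regularity, the upper one from the support being all of \<open>K\<close>.\<close>

lemma
  assumes x: "x \<in> K"
  shows AE_neq_point: "AE t in \<mu>. t \<noteq> x"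
    and integrable_ln_dist: "integrable \<mu> (\<lambda>t. ln \<bar>x - t\<bar>)"
    and integral_ln_dist: "(\<integral>t. ln \<bar>x - t\<bar> \<partial>\<mu>) = ln (log_cap K)"
proof -
  have "pot x \<le> ennreal v"
    using x pot_le_v_support support_eq_K by blast
  moreover have "x \<in> {-1..1}"
    using x K_subset by blast
  ultimately have X: "AE t in \<mu>. t \<noteq> x" "integrable \<mu> (\<lambda>t. ln \<bar>x - t\<bar>)"
    "pot x = ennreal (ln 2 - (\<integral>t. ln \<bar>x - t\<bar> \<partial>\<mu>))" "0 \<le> ln 2 - (\<integral>t. ln \<bar>x - t\<bar> \<partial>\<mu>)"
    using pot_finite by blast+
  have "pot x = ennreal v"
    using \<open>pot x \<le> ennreal v\<close> pot_ge_v[OF x] by (rule antisym)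
  then show "(\<integral>t. ln \<bar>x - t\<bar> \<partial>\<mu>) = ln (log_cap K)"
    using X(3,4) v_pos by (simp add: ln_log_cap)
  show "AE t in \<mu>. t \<noteq> x" "integrable \<mu> (\<lambda>t. ln \<bar>x - t\<bar>)"
    by (fact X)+
qed

end

section \<open>Near-Fekete sets\<close>

text \<open>Taken over ordered pairs, hence the square of the usual Vandermonde product.\<close>

definition vandermonde :: "real set \<Rightarrow> real" where
  "vandermonde X = (\<Prod>x\<in>X. \<Prod>y\<in>X - {x}. \<bar>x - y\<bar>)"

lemma vandermonde_pos: "finite X \<Longrightarrow> vandermonde X > 0"
  unfolding vandermonde_def by (intro prod_pos) auto

lemma vandermonde_insert:
  assumes "finite Y" "a \<notin> Y"
  shows "vandermonde (insert a Y) = vandermonde Y * (\<Prod>y\<in>Y. \<bar>a - y\<bar>)\<^sup>2"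
proof -
  have "(\<Prod>y\<in>insert a Y - {x}. \<bar>x - y\<bar>) = \<bar>a - x\<bar> * (\<Prod>y\<in>Y - {x}. \<bar>x - y\<bar>)" if "x \<in> Y" for x
  proof -
    have "insert a Y - {x} = insert a (Y - {x})"
      using that assms by auto
    then show ?thesis
      using assms by (simp add: abs_minus_commute)
  qed
  then have "(\<Prod>x\<in>Y. \<Prod>y\<in>insert a Y - {x}. \<bar>x - y\<bar>) = (\<Prod>x\<in>Y. \<bar>a - x\<bar>) * vandermonde Y"
    by (simp add: vandermonde_def prod.distrib)
  moreover have "insert a Y - {a} = Y"
    using assms by auto
  ultimately show ?thesis
    using assms by (simp add: vandermonde_def power2_eq_square)
qed

lemma vandermonde_le:
  assumes "X \<subseteq> {-1..1}"
  shows "vandermonde X \<le> (2 ^ card X) ^ card X"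
proof (cases "finite X")
  case True
  have "(\<Prod>y\<in>X - {x}. \<bar>x - y\<bar>) \<le> 2 ^ card X" if "x \<in> X" for x
  proof -
    have "\<bar>x - y\<bar> \<le> 2" if "y \<in> X" for y
      using subsetD[OF assms \<open>x \<in> X\<close>] subsetD[OF assms that] by (simp add: abs_le_iff)
    then have "(\<Prod>y\<in>X - {x}. \<bar>x - y\<bar>) \<le> (\<Prod>y\<in>X - {x}. 2)"
      by (intro prod_mono) auto
    also have "\<dots> = 2 ^ card (X - {x})"
      by simp
    also have "\<dots> \<le> 2 ^ card X"
      using True by (intro power_increasing card_mono) auto
    finally show ?thesis .
  qed
  then have "vandermonde X \<le> (\<Prod>x\<in>X. 2 ^ card X)"
    unfolding vandermonde_def by (intro prod_mono) (auto intro: prod_nonneg)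
  then show ?thesis
    by simp
qed (simp add: vandermonde_def)

text \<open>The push-forward by the identity only replaces the sigma-algebra of all subsets of
  \<open>X\<close> by the Borel sets of the line.\<close>

lemma uniform_count_measure_borel:
  fixes X :: "real set"
  assumes "finite X" "X \<noteq> {}" "X \<subseteq> K" "closed K"
  defines "N \<equiv> distr (uniform_count_measure X) borel (\<lambda>x. x)"
  shows "N \<in> prob_measures_on K"
    and "\<And>f :: real \<Rightarrow> real. f \<in> borel_measurable borel \<Longrightarrow> (\<integral>x. f x \<partial>N) = (\<Sum>x\<in>X. f x) / card X"
proof -
  interpret U: prob_space "uniform_count_measure X"
    using assms by (intro prob_space_uniform_count_measure)
  have meas: "(\<lambda>x. x) \<in> measurable (uniform_count_measure X) borel"
    by (simp add: measurable_def sets_uniform_count_measure space_uniform_count_measure)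
  show "N \<in> prob_measures_on K"
  proof (rule prob_measures_onI)
    show "real_distribution N"
      unfolding N_def using U.real_distribution_distr[OF meas] .
    show "AE x in N. x \<in> K"
      unfolding N_def using assms
      by (subst AE_distr_iff[OF meas]) (auto simp: space_uniform_count_measure intro!: AE_I2)
  qed fact
  show "(\<integral>x. f x \<partial>N) = (\<Sum>x\<in>X. f x) / card X" if "f \<in> borel_measurable borel" for f :: "real \<Rightarrow> real"
    unfolding N_def using that meas assms by (simp add: integral_distr integral_uniform_count_measure)
qed

context regular_interval_set
begin

abbreviation C :: real where
  "C \<equiv> log_cap K"

lemma infinite_K: "infinite K"
proof
  assume "finite K"
  then have "AE t in \<mu>. \<forall>x\<in>K. t \<noteq> x"
    by (rule AE_finite_allI) (rule AE_neq_point)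
  then have "AE t in \<mu>. False"
    using AE_K by eventually_elim auto
  then show False
    by simp
qed

text \<open>The mean over \<open>y\<close> of the logarithm of the product is
  \<open>card X * ln C\<close>. The factor 1/2 leaves the slack that yields the contradiction
  \<open>ln 2 <= 0\<close>.\<close>

lemma large_product_exists:
  assumes X: "finite X" "X \<subseteq> K"
  shows "\<exists>y\<in>K. C ^ card X / 2 \<le> (\<Prod>z\<in>X. \<bar>y - z\<bar>)"
proof (rule ccontr)
  assume "\<not> ?thesis"
  then have small: "(\<Prod>z\<in>X. \<bar>y - z\<bar>) < C ^ card X / 2" if "y \<in> K" for y
    using that by (meson not_le)
  have "AE y in \<mu>. \<forall>z\<in>X. y \<noteq> z"
    using X AE_neq_point by (intro AE_finite_allI) auto
  then have "AE y in \<mu>. (\<Sum>z\<in>X. ln \<bar>z - y\<bar>) \<le> card X * ln C - ln 2"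
    using AE_K
  proof eventually_elim
    case (elim y)
    have "(\<Sum>z\<in>X. ln \<bar>z - y\<bar>) = ln (\<Prod>z\<in>X. \<bar>y - z\<bar>)"
      using elim X by (subst ln_prod) (auto simp: abs_minus_commute)
    also have "\<dots> \<le> ln (C ^ card X / 2)"
      using small[of y] elim by (intro ln_mono prod_pos) auto
    also have "\<dots> = card X * ln C - ln 2"
      using log_cap_pos by (simp add: ln_divide_pos ln_realpow)
    finally show ?case .
  qed
  then have "(\<integral>y. (\<Sum>z\<in>X. ln \<bar>z - y\<bar>) \<partial>\<mu>) \<le> (\<integral>y. card X * ln C - ln 2 \<partial>\<mu>)"
    using X integrable_ln_dist by (intro integral_mono_AE Bochner_Integration.integrable_sum) auto
  moreover have "(\<integral>y. (\<Sum>z\<in>X. ln \<bar>z - y\<bar>) \<partial>\<mu>) = (\<Sum>z\<in>X. ln C)"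
  proof -
    have "(\<integral>y. (\<Sum>z\<in>X. ln \<bar>z - y\<bar>) \<partial>\<mu>) = (\<Sum>z\<in>X. \<integral>y. ln \<bar>z - y\<bar> \<partial>\<mu>)"
      using X integrable_ln_dist by (intro Bochner_Integration.integral_sum) auto
    also have "\<dots> = (\<Sum>z\<in>X. ln C)"
      using X integral_ln_dist by (intro sum.cong) auto
    finally show ?thesis .
  qed
  ultimately have "ln 2 \<le> (0::real)"
    by simp
  then show False
    by simp
qed

text \<open>Allowing the factor 4 avoids having to prove that the supremum is attained.\<close>
lemma near_Fekete_set_exists:
  "\<exists>X. finite X \<and> X \<subseteq> K \<and> card X = L \<and> (\<forall>x\<in>X. C ^ (L - 1) / 4 \<le> (\<Prod>y\<in>X - {x}. \<bar>x - y\<bar>))"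
proof -
  define S where "S = {vandermonde X | X. finite X \<and> X \<subseteq> K \<and> card X = L}"
  obtain X0 where X0: "finite X0" "card X0 = L" "X0 \<subseteq> K"
    using infinite_arbitrarily_large[OF infinite_K] by blast
  then have X0S: "vandermonde X0 \<in> S"
    by (auto simp: S_def)
  have bdd: "bdd_above S"
  proof (rule bdd_aboveI)
    fix s assume "s \<in> S"
    then show "s \<le> (2 ^ L) ^ L"
      using vandermonde_le K_subset unfolding S_def by force
  qed
  have "0 < Sup S"
    using vandermonde_pos[OF X0(1)] cSup_upper[OF X0S bdd] by linarith
  then have "Sup S / 4 < Sup S"
    by simp
  then obtain s where "s \<in> S" "Sup S / 4 < s"
    using less_cSup_iff[of S] X0S bdd by blast
  then obtain X where X: "finite X" "X \<subseteq> K" "card X = L" "Sup S < 4 * vandermonde X"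
    by (auto simp: S_def)
  have "C ^ (L - 1) / 4 \<le> (\<Prod>y\<in>X - {x}. \<bar>x - y\<bar>)" if x: "x \<in> X" for x
  proof -
    let ?Y = "X - {x}"
    have cY: "card ?Y = L - 1"
      using X x by simp
    \<comment> \<open>Exchanging \<open>x\<close> for \<open>y\<close> multiplies the Vandermonde
      product by less than 4, hence the product over \<open>?Y\<close> by less than 2; with the 1/2
      from the choice of \<open>y\<close> this gives the 1/4.\<close>
    obtain y where y: "y \<in> K" "C ^ (L - 1) / 2 \<le> (\<Prod>z\<in>?Y. \<bar>y - z\<bar>)"
      using large_product_exists[of ?Y] X cY by auto
    have pos: "0 < C ^ (L - 1) / 2"
      using log_cap_pos by simp
    have "y \<notin> ?Y"
    proof
      assume "y \<in> ?Y"
      then have "(\<Prod>z\<in>?Y. \<bar>y - z\<bar>) = 0"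
        using X by (intro prod_zero) auto
      then show False
        using y pos by simp
    qed
    then have "card (insert y ?Y) = L"
      using X x cY by (metis card_Suc_Diff1 card_insert_disjoint finite_Diff)
    then have "vandermonde (insert y ?Y) \<in> S"
      using X y by (auto simp: S_def)
    then have "vandermonde (insert y ?Y) \<le> Sup S"
      using bdd by (rule cSup_upper)
    also have "\<dots> < 4 * vandermonde (insert x ?Y)"
      using X x by (simp add: insert_absorb)
    finally have "vandermonde (insert y ?Y) < 4 * vandermonde (insert x ?Y)" .
    moreover have "vandermonde (insert y ?Y) = vandermonde ?Y * (\<Prod>z\<in>?Y. \<bar>y - z\<bar>)\<^sup>2"
      using X \<open>y \<notin> ?Y\<close> by (intro vandermonde_insert) auto
    moreover have "vandermonde (insert x ?Y) = vandermonde ?Y * (\<Prod>z\<in>?Y. \<bar>x - z\<bar>)\<^sup>2"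
      using X by (intro vandermonde_insert) auto
    ultimately have "vandermonde ?Y * (\<Prod>z\<in>?Y. \<bar>y - z\<bar>)\<^sup>2 < vandermonde ?Y * (2 * (\<Prod>z\<in>?Y. \<bar>x - z\<bar>))\<^sup>2"
      by (simp add: power_mult_distrib)
    then have "(\<Prod>z\<in>?Y. \<bar>y - z\<bar>)\<^sup>2 < (2 * (\<Prod>z\<in>?Y. \<bar>x - z\<bar>))\<^sup>2"
      using vandermonde_pos[of ?Y] X by simp
    then have "(\<Prod>z\<in>?Y. \<bar>y - z\<bar>) < 2 * (\<Prod>z\<in>?Y. \<bar>x - z\<bar>)"
      by (rule power_less_imp_less_base) (auto intro: prod_nonneg)
    then show ?thesis
      using y by simp
  qed
  then show ?thesis
    using X by blast
qed

text \<open>Off the diagonal \<open>abel_kernel_le\<close> turns each row sum into the logarithm of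
  a node product. The diagonal adds one bounded term per row, negligible after division by
  \<open>Suc j\<close> as \<open>j\<close> grows.\<close>

lemma abel_energy_near_Fekete:
  assumes X: "finite X" "X \<subseteq> K" "card X = Suc j"
    and F: "\<And>x. x \<in> X \<Longrightarrow> C ^ j / 4 \<le> (\<Prod>y\<in>X - {x}. \<bar>x - y\<bar>)"
    and r: "0 < r" "r < 1"
  shows "2 * ln 2 + abel_energy r (distr (uniform_count_measure X) borel (\<lambda>x. x))
    \<le> (j * (v - ln r) + (4 * ln 2 - 2 * ln (1 - r) + ln 4)) / Suc j"
proof -
  define N where "N = distr (uniform_count_measure X) borel (\<lambda>x. x)"
  have Xne: "X \<noteq> {}"
    using X by auto
  note U = uniform_count_measure_borel[OF X(1) Xne X(2) closed_K, folded N_def]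
  interpret N: interval_distribution N
    using U(1) by (rule interval_distribution_K)
  let ?L = "real (Suc j)"
  have "2 * ln 2 + abel_energy r N = 2 * ln 2 + (\<integral>x. \<integral>y. abel_kernel r x y \<partial>N \<partial>N)"
    using r by (simp add: N.integral_integral_abel_kernel)
  also have "(\<integral>x. \<integral>y. abel_kernel r x y \<partial>N \<partial>N) = (\<Sum>x\<in>X. \<Sum>y\<in>X. abel_kernel r x y) / ?L / ?L"
  proof -
    have [measurable]: "abel_kernel r x \<in> borel_measurable borel" for x
      unfolding abel_kernel_def by measurable
    have [measurable]: "(\<lambda>x. abel_kernel r x y) \<in> borel_measurable borel" for y
      unfolding abel_kernel_def by measurable
    have "(\<integral>y. abel_kernel r x y \<partial>N) = (\<Sum>y\<in>X. abel_kernel r x y) / ?L" for x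
      using U(2)[of "abel_kernel r x"] X by simp
    then show ?thesis
      using U(2)[of "\<lambda>x. (\<Sum>y\<in>X. abel_kernel r x y) / ?L"] X
      by (simp add: sum_divide_distrib[symmetric])
  qed
  also have "2 * ln 2 + (\<Sum>x\<in>X. \<Sum>y\<in>X. abel_kernel r x y) / ?L / ?L
    = (\<Sum>x\<in>X. \<Sum>y\<in>X. 2 * ln 2 + abel_kernel r x y) / ?L / ?L"
    using X by (simp add: sum.distrib add_divide_distrib)
  also have "\<dots> \<le> (\<Sum>x\<in>X. j * (v - ln r) + (4 * ln 2 - 2 * ln (1 - r) + ln 4)) / ?L / ?L"
  proof (intro divide_right_mono sum_mono)
    fix x assume x: "x \<in> X"
    have x1: "x \<in> {-1..1}"
      using x X K_subset by blast
    have cX: "card (X - {x}) = j"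
      using X x by simp
    have "(\<Sum>y\<in>X. 2 * ln 2 + abel_kernel r x y)
       = (2 * ln 2 + abel_kernel r x x) + (\<Sum>y\<in>X - {x}. 2 * ln 2 + abel_kernel r x y)"
      using X x by (simp add: sum.remove)
    also have "\<dots> \<le> (4 * ln 2 - 2 * ln (1 - r)) + (\<Sum>y\<in>X - {x}. ln 2 - ln r - ln \<bar>x - y\<bar>)"
    proof (intro add_mono sum_mono)
      show "2 * ln 2 + abel_kernel r x x \<le> 4 * ln 2 - 2 * ln (1 - r)"
        using abel_kernel_bounded[of r x x] r by simp
      fix y assume y: "y \<in> X - {x}"
      then have "y \<in> {-1..1}"
        using X K_subset by blast
      then show "2 * ln 2 + abel_kernel r x y \<le> ln 2 - ln r - ln \<bar>x - y\<bar>"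
        using abel_kernel_le[OF r x1, of y] y by auto
    qed
    also have "(\<Sum>y\<in>X - {x}. ln 2 - ln r - ln \<bar>x - y\<bar>) = j * (ln 2 - ln r) - ln (\<Prod>y\<in>X - {x}. \<bar>x - y\<bar>)"
    proof -
      have "ln (\<Prod>y\<in>X - {x}. \<bar>x - y\<bar>) = (\<Sum>y\<in>X - {x}. ln \<bar>x - y\<bar>)"
        using X by (intro ln_prod) auto
      then show ?thesis
        using cX by (simp add: sum_subtractf right_diff_distrib)
    qed
    also have "\<dots> \<le> j * (ln 2 - ln r) - ln (C ^ j / 4)"
      using F[OF x] log_cap_pos by (intro diff_left_mono ln_mono) auto
    also have "ln (C ^ j / 4) = j * (ln 2 - v) - ln 4"
      using log_cap_pos by (simp add: ln_divide_pos ln_realpow ln_log_cap)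
    finally show "(\<Sum>y\<in>X. 2 * ln 2 + abel_kernel r x y) \<le> j * (v - ln r) + (4 * ln 2 - 2 * ln (1 - r) + ln 4)"
      by (simp add: algebra_simps)
  qed auto
  also have "\<dots> = (j * (v - ln r) + (4 * ln 2 - 2 * ln (1 - r) + ln 4)) / ?L"
    using X by simp
  finally show ?thesis
    unfolding N_def .
qed

text \<open>The finite inequality on near-Fekete sets is divided by their size and passed to the
  limit; by the energy bound their counting measures subconverge to a minimiser, which is the
  equilibrium measure.\<close>

lemma integral_poly_equilibrium_ge:
  fixes Q :: "real poly"
  assumes deg: "degree Q > 0" and lc: "\<bar>lead_coeff Q\<bar> = 1" and nonneg: "\<And>x. x \<in> K \<Longrightarrow> poly Q x \<ge> 0"
  shows "2 * C ^ degree Q \<le> (\<integral>x. poly Q x \<partial>\<mu>)"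
proof -
  define N where "N = degree Q"
  have "\<forall>j. \<exists>X. finite X \<and> X \<subseteq> K \<and> card X = Suc j \<and> (\<forall>x\<in>X. C ^ j / 4 \<le> (\<Prod>y\<in>X - {x}. \<bar>x - y\<bar>))"
    using near_Fekete_set_exists[of "Suc _"] by simp
  then obtain X where X: "\<And>j. finite (X j)" "\<And>j. X j \<subseteq> K" "\<And>j. card (X j) = Suc j"
    and F: "\<And>j x. x \<in> X j \<Longrightarrow> C ^ j / 4 \<le> (\<Prod>y\<in>X j - {x}. \<bar>x - y\<bar>)"
    by metis
  have Xne: "X j \<noteq> {}" for j
    using X(3)[of j] by auto
  define M where "M j = distr (uniform_count_measure (X j)) borel (\<lambda>x. x)" for j
  note U = uniform_count_measure_borel[OF X(1) Xne X(2) closed_K, folded M_def]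
  define b where "b r j = (j * (v - ln r) + (4 * ln 2 - 2 * ln (1 - r) + ln 4)) / Suc j" for r :: real and j :: nat
  have "2 * ln 2 + abel_energy r (M j) \<le> b r j" if "0 < r" "r < 1" for r j
    unfolding b_def M_def using X F that by (intro abel_energy_near_Fekete) auto
  moreover have "b r \<longlonglongrightarrow> v - ln r" for r
    unfolding b_def by real_asymp
  ultimately obtain s M' where s: "strict_mono (s :: nat \<Rightarrow> nat)"
    and M': "M' \<in> prob_measures_on K" "kernel_energy M' = ennreal v"
    and conv: "\<And>(f :: real \<Rightarrow> real) B. continuous_on UNIV f \<Longrightarrow> (\<And>x. \<bar>f x\<bar> \<le> B) \<Longrightarrow>
       (\<lambda>j. \<integral>x. f x \<partial>M (s j)) \<longlonglongrightarrow> (\<integral>x. f x \<partial>M')"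
    using subseq_to_minimiser[where N = M and b = b, OF U(1)] by blast
  have M'_eq: "M' = \<mu>"
    using M' by (rule equilibrium_unique)
  \<comment> \<open>Clamping makes \<open>Q\<close> bounded on the line, as weak convergence
    requires, without changing it on \<open>K\<close>.\<close>
  define f where "f x = poly Q (cos (ang x))" for x
  have fc: "continuous_on UNIV f"
    unfolding f_def by (intro continuous_intros continuous_on_ang)
  have fm [measurable]: "f \<in> borel_measurable borel"
    using fc by (rule borel_measurable_continuous_onI)
  have feq: "f x = poly Q x" if "x \<in> K" for x
    using that K_subset by (auto simp: f_def cos_ang_eq)
  obtain B where "\<And>x. \<bar>f x\<bar> \<le> B"
  proof -
    have "compact (poly Q ` {-1..1})"
      by (intro compact_continuous_image continuous_intros) auto
    then have "bounded (poly Q ` {-1..1})"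
      by (rule compact_imp_bounded)
    then obtain B where B: "\<forall>y\<in>poly Q ` {-1..1}. norm y \<le> B"
      unfolding bounded_iff by blast
    have "\<bar>f x\<bar> \<le> B" for x
      using B[rule_format, of "f x"] by (simp add: f_def)
    then show ?thesis
      by (rule that)
  qed
  then have lim: "(\<lambda>j. \<integral>x. f x \<partial>M (s j)) \<longlonglongrightarrow> (\<integral>x. f x \<partial>\<mu>)"
    using conv[OF fc] M'_eq by blast
  \<comment> \<open>The bound of \<open>sum_poly_ge\<close> for \<open>c = C ^ N\<close> and
    \<open>d = C ^ j / 4\<close>, divided by \<open>Suc j\<close>. In the limit the two terms
    \<open>N * ln C\<close> cancel, which is why this \<open>c\<close> is chosen.\<close>
  define g where "g j = 2 * C ^ N * ((real (Suc j) - N) * (1 - N * ln C) + N * (j * ln C - ln 4 - ln (real (Suc j)))) / real (Suc j)" for j :: nat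
  have glim: "g \<longlonglongrightarrow> 2 * C ^ N"
  proof -
    have "(\<lambda>j. ((real (Suc j) - n) * (1 - n * a) + n * (j * a - ln 4 - ln (real (Suc j)))) / real (Suc j)) \<longlonglongrightarrow> 1" for n a :: real
      by real_asymp
    from tendsto_mult_left[OF this[of "real N" "ln C"], of "2 * C ^ N"] show ?thesis
      by (simp add: g_def[abs_def])
  qed
  have le: "g j \<le> (\<integral>x. f x \<partial>M j)" if "j \<ge> N" for j
  proof -
    have "2 * C ^ N * ((real (card (X j)) - degree Q) * (1 - ln (C ^ N)) + degree Q * ln (C ^ j / 4 / card (X j)))
       \<le> (\<Sum>x\<in>X j. poly Q x)"
    proof (rule sum_poly_ge)
      show "X j \<subseteq> {-1..1}"
        using X(2) K_subset by (rule subset_trans)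
      show "degree Q < card (X j)"
        using X(3) \<open>j \<ge> N\<close> by (simp add: N_def)
      show "poly Q x \<ge> 0" if "x \<in> X j" for x
        using that X nonneg by blast
    qed (use X F deg lc log_cap_pos in auto)
    moreover have "ln (C ^ j / 4 / card (X j)) = j * ln C - ln 4 - ln (real (Suc j))"
    proof -
      have "ln (C ^ j / 4 / card (X j)) = ln (C ^ j / 4) - ln (real (Suc j))"
        unfolding X(3) using log_cap_pos by (intro ln_divide_pos) auto
      then show ?thesis
        using log_cap_pos by (simp add: ln_divide_pos ln_realpow)
    qed
    ultimately have "g j * real (Suc j) \<le> (\<Sum>x\<in>X j. poly Q x)"
      using X log_cap_pos by (simp add: g_def N_def ln_realpow del: of_nat_Suc)
    also have "\<dots> = (\<Sum>x\<in>X j. f x)"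
      using feq[OF subsetD[OF X(2)]] by (intro sum.cong) auto
    finally show ?thesis
      using U(2)[OF fm, of j] X by (simp add: pos_le_divide_eq del: of_nat_Suc)
  qed
  have "2 * C ^ N \<le> (\<integral>x. f x \<partial>\<mu>)"
  proof (rule LIMSEQ_le)
    show "(\<lambda>j. g (s j)) \<longlonglongrightarrow> 2 * C ^ N"
      using LIMSEQ_subseq_LIMSEQ[OF glim s] by (simp add: o_def)
    show "(\<lambda>j. \<integral>x. f x \<partial>M (s j)) \<longlonglongrightarrow> (\<integral>x. f x \<partial>\<mu>)"
      by (rule lim)
    show "\<exists>n. \<forall>j\<ge>n. g (s j) \<le> (\<integral>x. f x \<partial>M (s j))"
      using le s by (intro exI[of _ N]) (meson order_trans seq_suble)
  qed
  also have "(\<integral>x. f x \<partial>\<mu>) = (\<integral>x. poly Q x \<partial>\<mu>)"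
  proof (rule integral_cong_AE)
    show "AE x in \<mu>. f x = poly Q x"
      using AE_K by eventually_elim (rule feq)
    have "poly Q \<in> borel_measurable borel"
      by (rule borel_measurable_continuous_onI) (use continuous_on_poly[of UNIV "\<lambda>x. x" Q] in simp)
    then show "poly Q \<in> borel_measurable \<mu>"
      by (simp only: eq.borel_measurable_eq)
  qed (simp add: eq.borel_measurable_eq)
  finally show ?thesis
    by (simp add: N_def)
qed

end

section \<open>Jacobi-type weights\<close>

locale jacobi_weight = regular_interval_set +
  fixes \<alpha> \<beta> :: nat
  assumes one_in_K: "1 \<in> K" and minus_one_in_K: "-1 \<in> K"
begin

definition w :: "real \<Rightarrow> real" where
  "w x = (1 - x) ^ \<alpha> * (1 + x) ^ \<beta>"

abbreviation M :: "real measure" where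
  "M \<equiv> density \<mu> (\<lambda>x. ennreal (w x))"

lemma w_measurable [measurable]: "w \<in> borel_measurable \<mu>"
  unfolding w_def eq.borel_measurable_eq by measurable

lemma w_nonneg: "x \<in> {-1..1} \<Longrightarrow> 0 \<le> w x"
  by (simp add: w_def)

lemma AE_w_nonneg: "AE x in \<mu>. 0 \<le> w x"
  using eq.AE_interval by eventually_elim (rule w_nonneg)

lemma AE_endpoints: "AE x in \<mu>. x \<in> {-1<..<1}"
  using eq.AE_interval AE_neq_point[OF one_in_K] AE_neq_point[OF minus_one_in_K]
  by eventually_elim auto

lemma w_pos: "x \<in> {-1<..<1} \<Longrightarrow> 0 < w x"
  by (simp add: w_def)

text \<open>On \<open>[-1, 1]\<close> the weight can vanish only at the endpoints, which carry no
  equilibrium mass.\<close>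

lemma measure_support_density: "measure_support M = K"
proof -
  have "emeasure M (ball x e) = 0 \<longleftrightarrow> emeasure \<mu> (ball x e) = 0" for x e
  proof -
    have [measurable]: "ball x e \<in> sets borel"
      by simp
    have "emeasure M (ball x e) = (\<integral>\<^sup>+t. ennreal (w t) * indicator (ball x e) t \<partial>\<mu>)"
      by (intro emeasure_density) auto
    also have "\<dots> = 0 \<longleftrightarrow> (AE t in \<mu>. ennreal (w t) * indicator (ball x e) t = 0)"
      by (intro nn_integral_0_iff_AE) measurable
    also have "\<dots> \<longleftrightarrow> (AE t in \<mu>. t \<notin> ball x e)"
    proof
      assume "AE t in \<mu>. ennreal (w t) * indicator (ball x e) t = 0"
      then show "AE t in \<mu>. t \<notin> ball x e"
        using AE_endpoints
      proof eventually_elim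
        case (elim t)
        have "\<not> w t \<le> 0"
          using w_pos[OF elim(2)] by simp
        then show ?case
          using elim(1) by (auto simp: indicator_def ennreal_eq_0_iff)
      qed
    next
      assume "AE t in \<mu>. t \<notin> ball x e"
      then show "AE t in \<mu>. ennreal (w t) * indicator (ball x e) t = 0"
        by eventually_elim simp
    qed
    also have "\<dots> \<longleftrightarrow> emeasure \<mu> (ball x e) = 0"
      by (rule AE_iff_measurable) auto
    finally show ?thesis .
  qed
  then have "measure_support M = measure_support \<mu>"
    by (simp add: measure_support_def)
  then show ?thesis
    by (simp add: support_eq_K)
qed

text \<open>Nonnegativity is demanded on the whole line, while \<open>w\<close> may be negative
  outside \<open>[-1, 1]\<close>. The singular part is zero.\<close>

lemma lebesgue_ac_density_weight: "lebesgue_ac_density \<mu> M (\<lambda>x. max 0 (w x))"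
  unfolding lebesgue_ac_density_def
proof (intro conjI exI[of _ "null_measure borel"])
  show "(\<lambda>x. max 0 (w x)) \<in> borel_measurable borel"
    unfolding w_def by measurable
  show "\<forall>x. 0 \<le> max 0 (w x)" "sets (null_measure borel) = sets borel"
    by auto
  show "\<exists>A\<in>sets borel. emeasure \<mu> A = 0 \<and> emeasure (null_measure borel) (UNIV - A) = 0"
    by (intro bexI[of _ "{}"]) auto
  have "density \<mu> (\<lambda>x. ennreal (max 0 (w x))) = M"
    by (simp add: ennreal_max_0)
  then show "\<forall>A\<in>sets borel. emeasure M A
      = emeasure (density \<mu> (\<lambda>x. ennreal (max 0 (w x)))) A + emeasure (null_measure borel) A"
    by simp
qed

text \<open>\<open>szego_S\<close> takes its density by \<open>SOME\<close>, so an arbitrary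
  decomposition has to be treated. Outside the null set \<open>A\<close>, which carries the singular
  part, the two densities give the same measure.\<close>

lemma lebesgue_ac_density_unique:
  assumes "lebesgue_ac_density \<mu> M f"
  shows "AE x in \<mu>. f x = w x"
proof -
  obtain ms A where f: "f \<in> borel_measurable borel" "\<And>x. f x \<ge> 0"
    and ms: "sets ms = sets borel" "A \<in> sets borel" "emeasure \<mu> A = 0" "emeasure ms (UNIV - A) = 0"
    and eqM: "\<And>B. B \<in> sets borel \<Longrightarrow> emeasure M B = emeasure (density \<mu> (\<lambda>x. ennreal (f x))) B + emeasure ms B"
    using assms unfolding lebesgue_ac_density_def by blast
  have fm [measurable]: "f \<in> borel_measurable \<mu>"
    using f by (simp only: eq.borel_measurable_eq)
  have null: "A \<in> null_sets (density \<mu> h)" if "h \<in> borel_measurable \<mu>" for h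
    using absolutely_continuousI_density[OF that] ms by (auto simp: absolutely_continuous_def null_sets_def)
  have "density \<mu> (\<lambda>x. ennreal (f x)) = M"
  proof (rule measure_eqI)
    fix B assume "B \<in> sets (density \<mu> (\<lambda>x. ennreal (f x)))"
    then have B: "B \<in> sets borel"
      by simp
    have "emeasure ms (B - A) \<le> emeasure ms (UNIV - A)"
      using ms by (intro emeasure_mono) auto
    then have "emeasure M (B - A) = emeasure (density \<mu> (\<lambda>x. ennreal (f x))) (B - A)"
      using eqM[of "B - A"] B ms by simp
    then show "emeasure (density \<mu> (\<lambda>x. ennreal (f x))) B = emeasure M B"
      using B null[of "\<lambda>x. ennreal (f x)"] null[of "\<lambda>x. ennreal (w x)"]
      by (simp add: emeasure_Diff_null_set)
  qed simp
  then have "AE x in \<mu>. ennreal (f x) = ennreal (w x)"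
    by (intro eq.density_unique) auto
  then show ?thesis
    using AE_w_nonneg by eventually_elim (use f in \<open>simp add: ennreal_inj\<close>)
qed

text \<open>\<open>ln (w x)\<close> combines \<open>ln |1 - x|\<close> and
  \<open>ln |-1 - x|\<close>, and both endpoints lie in \<open>K\<close>, where Frostman's equality
  evaluates the integrals.\<close>

lemma szego_S_eq: "szego_S M = C ^ (\<alpha> + \<beta>)"
proof -
  define f where "f = (SOME f. lebesgue_ac_density \<mu> M f)"
  have f: "AE x in \<mu>. f x = w x"
    unfolding f_def
    by (rule lebesgue_ac_density_unique[OF someI[of "lebesgue_ac_density \<mu> M", OF lebesgue_ac_density_weight]])
  define g where "g x = \<alpha> * ln \<bar>1 - x\<bar> + \<beta> * ln \<bar>-1 - x\<bar>" for x :: real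
  have int: "integrable \<mu> g"
    unfolding g_def using integrable_ln_dist[OF one_in_K] integrable_ln_dist[OF minus_one_in_K] by simp
  have Ig: "(\<integral>x. g x \<partial>\<mu>) = (\<alpha> + \<beta>) * ln C"
    unfolding g_def
    using integrable_ln_dist[OF one_in_K] integrable_ln_dist[OF minus_one_in_K]
      integral_ln_dist[OF one_in_K] integral_ln_dist[OF minus_one_in_K]
    by (simp add: algebra_simps)
  have fg: "AE x in \<mu>. f x > 0 \<and> ln (f x) = g x"
    using f AE_endpoints
  proof eventually_elim
    case (elim x)
    have "\<bar>1 - x\<bar> = 1 - x" "\<bar>-1 - x\<bar> = 1 + x"
      using elim by auto
    then have "ln (w x) = g x"
      using elim unfolding w_def g_def by (subst ln_mult_pos) (auto simp: ln_realpow)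
    then show ?case
      using elim w_pos by simp
  qed
  \<comment> \<open>\<open>szego_S\<close> integrates positive and negative parts separately;
    integrability makes both finite, so no case of infinite value arises.\<close>
  obtain p q where pq: "0 \<le> p" "0 \<le> q" "(\<integral>\<^sup>+x. ennreal (g x) \<partial>\<mu>) = ennreal p"
    "(\<integral>\<^sup>+x. ennreal (- g x) \<partial>\<mu>) = ennreal q" "(\<integral>x. g x \<partial>\<mu>) = p - q"
    using integrableE[OF int] by metis
  have "(\<integral>\<^sup>+x. ennreal (ln (f x)) \<partial>\<mu>) = ennreal p"
    unfolding pq(3)[symmetric] by (rule nn_integral_cong_AE) (use fg in \<open>eventually_elim, simp\<close>)
  moreover have "(\<integral>\<^sup>+x. (if f x = 0 then \<infinity> else ennreal (- ln (f x))) \<partial>\<mu>) = ennreal q"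
    unfolding pq(4)[symmetric] by (rule nn_integral_cong_AE) (use fg in \<open>eventually_elim, simp\<close>)
  ultimately have "szego_S M = exp (p - q)"
    unfolding szego_S_def measure_support_density Let_def f_def[symmetric]
    using pq by (simp add: enn2ereal_ennreal)
  also have "\<dots> = C ^ (\<alpha> + \<beta>)"
    using Ig pq(5) log_cap_pos by (metis exp_ln exp_of_nat_mult)
  finally show ?thesis .
qed

lemma integral_sq_ge:
  fixes p :: "real poly"
  assumes "degree p = n" "lead_coeff p = 1" "n \<ge> 1"
  shows "2 * C ^ (2 * n + \<alpha> + \<beta>) \<le> (\<integral>x. (poly p x)\<^sup>2 \<partial>M)"
proof -
  define Q where "Q = p ^ 2 * ([:1, -1:] ^ \<alpha> * [:1, 1:] ^ \<beta>)"
  have "p \<noteq> 0"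
    using assms by auto
  then have deg: "degree Q = 2 * n + \<alpha> + \<beta>"
    using assms by (simp add: Q_def degree_mult_eq degree_power_eq)
  have lc: "\<bar>lead_coeff Q\<bar> = 1"
    using assms by (simp add: Q_def lead_coeff_mult lead_coeff_power abs_mult power_abs)
  have Qx: "poly Q x = w x * (poly p x)\<^sup>2" for x
    by (simp add: Q_def w_def poly_power mult.commute)
  have "2 * C ^ degree Q \<le> (\<integral>x. poly Q x \<partial>\<mu>)"
  proof (rule integral_poly_equilibrium_ge[OF _ lc])
    show "0 < degree Q"
      using deg assms by simp
    show "0 \<le> poly Q x" if "x \<in> K" for x
      unfolding Qx using w_nonneg that K_subset by (intro mult_nonneg_nonneg) auto
  qed
  also have "\<dots> = (\<integral>x. (poly p x)\<^sup>2 \<partial>M)"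
    unfolding Qx using AE_w_nonneg
    by (subst integral_real_density)
       (auto simp: eq.borel_measurable_eq intro!: borel_measurable_continuous_onI continuous_intros)
  finally show ?thesis
    by (simp add: deg)
qed

lemma widom2_sq_ge:
  assumes "n \<ge> 1"
  shows "2 * szego_S M \<le> (widom2 M n)\<^sup>2"
proof -
  have ge: "2 * C ^ (2 * n + \<alpha> + \<beta>) \<le> min_monic_norm2 M n"
    unfolding min_monic_norm2_def
  proof (rule cInf_greatest)
    have "degree (monom 1 n :: real poly) = n" "lead_coeff (monom 1 n :: real poly) = 1"
      by (simp_all add: degree_monom_eq)
    then show "{\<integral>x. (poly p x)\<^sup>2 \<partial>M |p :: real poly. degree p = n \<and> lead_coeff p = 1} \<noteq> {}"
      by blast
  qed (use integral_sq_ge assms in blast)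
  have "0 \<le> 2 * C ^ (2 * n + \<alpha> + \<beta>)"
    using log_cap_pos by simp
  then have "(widom2 M n)\<^sup>2 = min_monic_norm2 M n / C ^ (2 * n)"
    unfolding widom2_def measure_support_density using ge
    by (simp add: power_divide power_mult[symmetric] mult.commute)
  also have "\<dots> \<ge> 2 * C ^ (2 * n + \<alpha> + \<beta>) / C ^ (2 * n)"
    using ge log_cap_pos by (intro divide_right_mono) auto
  also have "2 * C ^ (2 * n + \<alpha> + \<beta>) / C ^ (2 * n) = 2 * szego_S M"
    using log_cap_pos by (simp add: szego_S_eq power_add)
  finally show ?thesis .
qed

end

theorem theorem2:
  fixes K :: "real set" and \<alpha> \<beta> n :: nat
  assumes "compact K" and "dirichlet_regular K"
    and "K \<subseteq> {-1..1}" and "1 \<in> K" and "-1 \<in> K"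
    and "\<alpha> + \<beta> \<ge> 1" and "n \<ge> 1"
  shows "(widom2 (density (equilibrium_measure K)
              (\<lambda>x. ennreal ((1 - x) ^ \<alpha> * (1 + x) ^ \<beta>))) n)\<^sup>2
         \<ge> 2 * szego_S (density (equilibrium_measure K)
              (\<lambda>x. ennreal ((1 - x) ^ \<alpha> * (1 + x) ^ \<beta>)))"
proof -
  interpret jacobi_weight K \<alpha> \<beta>
    by unfold_locales (use assms in \<open>auto simp: dirichlet_regular_def\<close>)
  show ?thesis
    using widom2_sq_ge[OF \<open>n \<ge> 1\<close>] by (simp add: w_def)
qed

end
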